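(* Let $g\in C^1(\mathbb{R}^n)$ and $u(x,t)=\min_{|x-y|\le t}g(y)$. Then $\Sigma$ is composed of at most countably many connected components or almost connected components. That is, $\Sigma=\bigcup_j\Sigma_j$ (an at most countable union), where each $\Sigma_j$ is a connected component or an almost connected component of $\Sigma$, and each $\Sigma_j$ is a finite or countable union of some of the sets $T(F_i)\setminus\{(x,t) : (x,t)\text{ has a unique minimizer}\}$.
   Context: $|\cdot|$ is the Euclidean norm. $u$ is the Hopf–Lax solution of $u_t+|\nabla u|=0$ with $u(\cdot,0)=g$. A point $y$ is a minimizer for $(x,t)$ if $|y-x|\le t$ and $u(x,t)=g(y)$. $\Sigma\subset\mathbb{R}^n\times\{t>0\}$ is the set of points where $u$ is not differentiable. For $y_0$ with $Dg(y_0)\ne0$ put $X(y_0,t)=y_0+\frac{Dg(y_0)}{|Dg(y_0)|}t$ and define, in $[0,\infty]$, $\overline t_s(y_0)=\sup\{t>0 : y_0$ is the unique minimizer for $(X(y_0,t),t)\}$ and $t_s(y_0)=\inf\{t>0 : y_0$ is not a minimizer for $(X(y_0,t),t)\}$ (with $\sup\emptyset=0$, $\inf\emptyset=\infty$); one has $\overline t_s\le t_s$. $M=\{y_0 : Dg(y_0)\neq0,\ \overline t_s(y_0)<\infty\}$. For $S\subset M$, $T(S)$ is the set of points $(X(y_0,t),t)$ with $y_0\in S$ and $t\in[\overline t_s(y_0),t_s(y_0)]$ if $t_s(y_0)<\infty$, $t\in[\overline t_s(y_0),\infty)$ if $t_s(y_0)=\infty$. $H_{y_0}=\{y : (y-y_0)\cdot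 Dg(y_0)>0\}$ and $E=\{y_0 : Dg(y_0)\ne0,\ \exists\,\bar y\in H_{y_0}$ with $g(\bar y)<g(y_0)\}$. The $E_i$ are the path connected components of $E$. For $y_0$ with $Dg(y_0)\neq 0$, $H^+(y_0)$ is the set of points $y$ in a small neighborhood of $y_0$ (on which the level set $\{g=g(y_0)\}$ is a $C^1$ hypersurface separating the neighborhood) with $g(y)>g(y_0)$. $F_i$ is the union of $E_i$ with all $y_0\in M\setminus E$ for which there is a neighborhood $U$ of $y_0$ with $U\cap H^+(y_0)\subset E_i$. A set $C$ is almost connected if for any two disjoint nonempty (relatively) closed subsets $A,B$ of $C$ with $C=A\cup B$ one has $\mathrm{dist}(A,B)=\inf_{a\in A,b\in B}|a-b|=0$. A (connected, almost connected) component of a set is a maximal (connected, almost connected) subset. *)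

theory Defs
  imports "HOL-Analysis.Analysis"
begin

text \<open>
  Space is \<open>real ^ 'n\<close>, space-time is \<open>(real ^ 'n) \<times> real\<close>; the product norm of the library is
  the Euclidean one.
\<close>

definition grad :: "(real ^ 'n \<Rightarrow> real) \<Rightarrow> real ^ 'n \<Rightarrow> real ^ 'n" where
  "grad f x = (THE D. GDERIV f x :> D)"

text \<open>Intended for open \<open>V\<close>.\<close>

definition C1_on :: "(real ^ 'n \<Rightarrow> real) \<Rightarrow> (real ^ 'n) set \<Rightarrow> bool" where
  "C1_on f V \<longleftrightarrow> (\<forall>x\<in>V. f differentiable (at x)) \<and> continuous_on V (grad f)"

text \<open>
  For continuous \<open>g\<close> and \<open>t \<ge> 0\<close> the infimum is a minimum over a compact ball; for \<open>t = 0\<close> it is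
  \<open>g x\<close>. Values at \<open>t < 0\<close> are irrelevant.
\<close>

definition hopf_lax :: "(real ^ 'n \<Rightarrow> real) \<Rightarrow> (real ^ 'n) \<times> real \<Rightarrow> real" where
  "hopf_lax g = (\<lambda>(x, t). INF y\<in>cball x t. g y)"

definition singular_set :: "(real ^ 'n \<Rightarrow> real) \<Rightarrow> ((real ^ 'n) \<times> real) set" where
  "singular_set g = {(x, t). t > 0 \<and> \<not> hopf_lax g differentiable (at (x, t))}"

definition minimizer :: "(real ^ 'n \<Rightarrow> real) \<Rightarrow> (real ^ 'n) \<times> real \<Rightarrow> real ^ 'n \<Rightarrow> bool" where
  "minimizer g = (\<lambda>(x, t) y. norm (y - x) \<le> t \<and> hopf_lax g (x, t) = g y)"

definition unique_minimizer :: "(real ^ 'n \<Rightarrow> real) \<Rightarrow> (real ^ 'n) \<times> real \<Rightarrow> real ^ 'n \<Rightarrow> bool" where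
  "unique_minimizer g p y \<longleftrightarrow> minimizer g p y \<and> (\<forall>z. minimizer g p z \<longrightarrow> z = y)"

definition unique_minimizer_set :: "(real ^ 'n \<Rightarrow> real) \<Rightarrow> ((real ^ 'n) \<times> real) set" where
  "unique_minimizer_set g = {p. \<exists>y. unique_minimizer g p y}"

definition char_line :: "(real ^ 'n \<Rightarrow> real) \<Rightarrow> real ^ 'n \<Rightarrow> real \<Rightarrow> real ^ 'n" where
  "char_line g y0 t = y0 + t *\<^sub>R (grad g y0 /\<^sub>R norm (grad g y0))"

text \<open>In \<open>ennreal\<close> the empty supremum is \<open>0\<close> and the empty infimum is \<open>\<infinity>\<close>.\<close>

definition ts_bar :: "(real ^ 'n \<Rightarrow> real) \<Rightarrow> real ^ 'n \<Rightarrow> ennreal" where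
  "ts_bar g y0 = (SUP t\<in>{t. t > 0 \<and> unique_minimizer g (char_line g y0 t, t) y0}. ennreal t)"

definition ts :: "(real ^ 'n \<Rightarrow> real) \<Rightarrow> real ^ 'n \<Rightarrow> ennreal" where
  "ts g y0 = (INF t\<in>{t. t > 0 \<and> \<not> minimizer g (char_line g y0 t, t) y0}. ennreal t)"

definition M_set :: "(real ^ 'n \<Rightarrow> real) \<Rightarrow> (real ^ 'n) set" where
  "M_set g = {y0. grad g y0 \<noteq> 0 \<and> ts_bar g y0 < \<infinity>}"

text \<open>
  The real parameter \<open>t\<close> is finite, so for \<open>ts g y0 = \<infinity>\<close> the last conjunct is void. The condition
  \<open>t \<ge> 0\<close> is needed since \<open>ennreal\<close> sends negative reals to \<open>0\<close>.
\<close>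

definition T_set :: "(real ^ 'n \<Rightarrow> real) \<Rightarrow> (real ^ 'n) set \<Rightarrow> ((real ^ 'n) \<times> real) set" where
  "T_set g S = {(char_line g y0 t, t) | y0 t.
     y0 \<in> S \<and> t \<ge> 0 \<and> ts_bar g y0 \<le> ennreal t \<and> ennreal t \<le> ts g y0}"

definition half_space :: "(real ^ 'n \<Rightarrow> real) \<Rightarrow> real ^ 'n \<Rightarrow> (real ^ 'n) set" where
  "half_space g y0 = {y. (y - y0) \<bullet> grad g y0 > 0}"

definition E_set :: "(real ^ 'n \<Rightarrow> real) \<Rightarrow> (real ^ 'n) set" where
  "E_set g = {y0. grad g y0 \<noteq> 0 \<and> (\<exists>y\<in>half_space g y0. g y < g y0)}"

definition path_comps :: "(real ^ 'n) set \<Rightarrow> (real ^ 'n) set set" where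
  "path_comps S = {path_component_set S x | x. x \<in> S}"

definition C1_hypersurface :: "(real ^ 'n) set \<Rightarrow> bool" where
  "C1_hypersurface S \<longleftrightarrow>
     (\<forall>p\<in>S. \<exists>V \<phi>. open V \<and> p \<in> V \<and> C1_on \<phi> V \<and> (\<forall>y\<in>V. grad \<phi> y \<noteq> 0) \<and>
        S \<inter> V = {y\<in>V. \<phi> y = 0})"

text \<open>
  The neighbourhoods of \<open>y0\<close> on which the level set of \<open>g\<close> through \<open>y0\<close> is a hypersurface that
  separates the neighbourhood, i.e. whose removal disconnects it.
\<close>

definition level_nbhd :: "(real ^ 'n \<Rightarrow> real) \<Rightarrow> real ^ 'n \<Rightarrow> (real ^ 'n) set \<Rightarrow> bool" where
  "level_nbhd g y0 N \<longleftrightarrow> open N \<and> y0 \<in> N \<and> connected N \<and>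
     C1_hypersurface {y\<in>N. g y = g y0} \<and> \<not> connected (N - {y\<in>N. g y = g y0})"

definition H_plus :: "(real ^ 'n \<Rightarrow> real) \<Rightarrow> (real ^ 'n) set \<Rightarrow> real ^ 'n \<Rightarrow> (real ^ 'n) set" where
  "H_plus g N y0 = {y\<in>N. g y > g y0}"

text \<open>
  \<open>C\<close> stands for a path component of \<open>E_set g\<close>. The choice of the small neighbourhood \<open>N\<close> does not
  matter, because \<open>U\<close> may be shrunk.
\<close>

definition F_set :: "(real ^ 'n \<Rightarrow> real) \<Rightarrow> (real ^ 'n) set \<Rightarrow> (real ^ 'n) set" where
  "F_set g C = C \<union> {y0 \<in> M_set g - E_set g.
     \<exists>N U. level_nbhd g y0 N \<and> open U \<and> y0 \<in> U \<and> U \<inter> H_plus g N y0 \<subseteq> C}"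

definition almost_connected :: "'a::metric_space set \<Rightarrow> bool" where
  "almost_connected C \<longleftrightarrow>
     (\<forall>A B. closedin (top_of_set C) A \<and> closedin (top_of_set C) B \<and> A \<noteq> {} \<and> B \<noteq> {} \<and>
        A \<inter> B = {} \<and> C = A \<union> B \<longrightarrow> setdist A B = 0)"

definition almost_components :: "'a::metric_space set \<Rightarrow> 'a set set" where
  "almost_components S = {C. C \<subseteq> S \<and> almost_connected C \<and>
     (\<forall>D. C \<subseteq> D \<and> D \<subseteq> S \<and> almost_connected D \<longrightarrow> D = C)}"

end

theory Submission
  imports Defs
begin

text \<open>
Let \<open>\<nu> y\<close> be the normalized gradient at \<open>y\<close> and \<open>p\<^sub>s y = (y + s \<nu> y, s)\<close> the characteristic through \<open>y\<close>.
A minimizer with nonzero gradient lies on the boundary of its ball, the gradient pointing to the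
centre; so the space-time point lies on the characteristic of the minimizer. Comparing \<open>u\<close> with
the functions \<open>(x, t) \<mapsto> g (x + t w)\<close> for fixed \<open>w\<close> in the unit ball shows that the singular points are exactly
the points with several minimizers, one of which has nonzero gradient (\<open>singular_set_eq\<close>).
Hence the singular set is the union of the sets
\<open>G\<^sub>C = T(F\<^sub>C) - {points with a unique minimizer}\<close>, where \<open>C\<close> ranges over the path components of \<open>E\<close>
(\<open>singular_set_union\<close>). Since \<open>E\<close> is open, there are countably many \<open>C\<close>.

The heart of the proof is that every \<open>G\<^sub>C\<close> is almost connected. Given this, the almost components of the
singular set partition it, each of them swallows every \<open>G\<^sub>C\<close> that it meets, and this gives
the countable decomposition.

Suppose then that \<open>G\<^sub>C\<close> is split into two parts at distance at least \<open>\<delta> > 0\<close>. For \<open>y\<close> in \<open>C\<close> the set of times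
at which \<open>y\<close> is a minimizer is an interval \<open>[0, \<tau> y]\<close>, the cut time \<open>\<tau>\<close> is upper semicontinuous, and
the cut point \<open>p\<^bsub>\<tau> y\<^esub> y\<close> gives \<open>y\<close> a colour: the part whose closure contains it.
Three facts make this work.

\<^item> The cut point lies in the closure of \<open>G\<^sub>C\<close>. Otherwise minimizers would be unique and
  depend continuously on the point near the cut point, and a fixed point argument produces a
  characteristic that passes through the cut point and remains minimizing for a while
  (\<open>cut_point_in_closure\<close>).

\<^item> If a point \<open>p\<^sub>s y\<close> with \<open>0 < s < \<tau> y\<close> lies in the closure of the singular set, so do all later points
  of the characteristic up to the cut point (\<open>singular_closure_propagates\<close>). Indeed, where minimizers are
  unique, moving points back along their characteristics is continuous and injective, so by
  invariance of domain a neighbourhood of the later point without singular points is carried onto a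
  neighbourhood of the earlier one, again without singular points. As the two parts are
  \<open>\<delta>\<close>-separated, the colour cannot change in this propagation (\<open>cut_point_colour\<close>).

\<^item> By compactness and the upper semicontinuity of \<open>\<tau>\<close> the colour, seen as a function of space-time points
  whose minimizers all lie in \<open>C\<close>, is well defined and locally constant
  (\<open>coloured_disjoint\<close>, \<open>coloured_limit\<close>).

The cut time can vanish and jumps in general, so the colour is compared not along a path in \<open>C\<close> itself but
along this path lifted to a small positive time (\<open>colour_constant\<close>). Finally, the singular ray
of a point of \<open>F\<^sub>C\<close> outside \<open>C\<close> is connected and has distance \<open>0\<close> from the cut points of \<open>C\<close>
(\<open>boundary_ray_approximation\<close>), so it belongs to the same part.
\<close>

section \<open>Almost connected sets and their components\<close>

text \<open>
The \<open>\<delta>\<close>-saturated subsets of \<open>G\<close> are the unions of classes of points joined by chains in \<open>G\<close> with steps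
shorter than \<open>\<delta>\<close>. They replace pairs of separated closed sets: the complement in \<open>G\<close> is the other part.
\<close>

definition saturated :: "real \<Rightarrow> 'a::metric_space set \<Rightarrow> 'a set \<Rightarrow> bool" where
  "saturated \<delta> G B \<longleftrightarrow> B \<subseteq> G \<and> (\<forall>b\<in>B. \<forall>q\<in>G. dist b q < \<delta> \<longrightarrow> q \<in> B)"

lemma saturated_Diff: "saturated \<delta> G B \<Longrightarrow> saturated \<delta> G (G - B)"
  unfolding saturated_def by (metis Diff_iff Diff_subset dist_commute)

lemma saturated_closure:
  assumes B: "saturated \<delta> G B" and p: "p \<in> closure B" and q: "q \<in> closure G" and d: "dist p q < \<delta>"
  shows "q \<in> closure B"
  unfolding closure_approachable
proof (intro allI impI)
  fix e :: real assume e: "0 < e"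
  define e' where "e' = min e ((\<delta> - dist p q) / 2)"
  have e': "0 < e'" "e' \<le> e" "2 * e' \<le> \<delta> - dist p q" using e d by (auto simp: e'_def min_def)
  obtain b where b: "b \<in> B" "dist b p < e'" using p e' unfolding closure_approachable by blast
  obtain a where a: "a \<in> G" "dist a q < e'" using q e' unfolding closure_approachable by blast
  have "dist b a \<le> dist b p + dist p q + dist q a"
    using dist_triangle[of b a p] dist_triangle[of p a q] by linarith
  then have "dist b a < \<delta>" using a b e' by (simp add: dist_commute)
  then have "a \<in> B" using B a b by (auto simp: saturated_def)
  then show "\<exists>y\<in>B. dist y q < e" using a e' by force
qed

lemma saturated_disjoint_closure:
  assumes "0 < \<delta>" "saturated \<delta> G B" "p \<in> closure B" "p \<in> closure (G - B)"
  shows False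
proof -
  obtain b where b: "b \<in> B" "dist b p < \<delta> / 2" using assms unfolding closure_approachable by (meson half_gt_zero)
  obtain a where a: "a \<in> G - B" "dist a p < \<delta> / 2" using assms unfolding closure_approachable by (meson half_gt_zero)
  have "dist b a < \<delta>" using a b dist_triangle2[of b a p] by linarith
  then show False using assms a b by (auto simp: saturated_def)
qed

lemma saturated_connected:
  assumes \<delta>: "0 < \<delta>" and B: "saturated \<delta> G B" and K: "connected K" "K \<subseteq> G" "K \<inter> B \<noteq> {}"
  shows "K \<subseteq> B"
proof (rule ccontr)
  assume "\<not> K \<subseteq> B"
  then have "K \<inter> (G - B) \<noteq> {}" using K by blast
  moreover have "B \<subseteq> closure B" "G - B \<subseteq> closure (G - B)" by (auto simp: closure_subset)
  moreover have "closure B \<inter> closure (G - B) = {}" using saturated_disjoint_closure[OF \<delta> B] by blast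
  ultimately have "\<exists>S T. closed S \<and> closed T \<and> K \<subseteq> S \<union> T \<and> S \<inter> T \<inter> K = {} \<and> S \<inter> K \<noteq> {} \<and> T \<inter> K \<noteq> {}"
    using K by (intro exI[of _ "closure B"] exI[of _ "closure (G - B)"]) auto
  then show False using K(1) unfolding connected_closed by blast
qed

text \<open>
A \<open>\<delta>\<close>-saturated set and its complement in \<open>G\<close> have distance at least \<open>\<delta>\<close>, hence are both relatively
closed; conversely two parts at positive distance \<open>\<delta>\<close> are \<open>\<delta>\<close>-saturated.
\<close>

lemma almost_connected_iff:
  "almost_connected G \<longleftrightarrow> (\<forall>\<delta> B. 0 < \<delta> \<longrightarrow> saturated \<delta> G B \<longrightarrow> B \<noteq> {} \<longrightarrow> B = G)"
proof
  assume G: "almost_connected G"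
  show "\<forall>\<delta> B. 0 < \<delta> \<longrightarrow> saturated \<delta> G B \<longrightarrow> B \<noteq> {} \<longrightarrow> B = G"
  proof (intro allI impI, rule ccontr)
    fix \<delta> :: real and B assume *: "0 < \<delta>" "saturated \<delta> G B" "B \<noteq> {}" "B \<noteq> G"
    have sub: "B \<subseteq> G" using * by (simp add: saturated_def)
    have cl: "closedin (top_of_set G) A" if "saturated \<delta> G A" for A
    proof -
      have "A = G \<inter> closure A"
        using saturated_disjoint_closure[OF *(1) that] that closure_subset[of A] closure_subset[of "G - A"]
        unfolding saturated_def by blast
      then show ?thesis using closedin_closed_Int[of "closure A" G] by simp
    qed
    have "setdist B (G - B) = 0"
      using G cl[OF *(2)] cl[OF saturated_Diff[OF *(2)]] * sub unfolding almost_connected_def by blast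
    moreover have "\<delta> \<le> setdist B (G - B)"
      using * sub by (intro le_setdistI) (auto simp: saturated_def not_less[symmetric])
    ultimately show False using * by simp
  qed
next
  assume *: "\<forall>\<delta> B. 0 < \<delta> \<longrightarrow> saturated \<delta> G B \<longrightarrow> B \<noteq> {} \<longrightarrow> B = G"
  show "almost_connected G" unfolding almost_connected_def
  proof (intro allI impI, rule ccontr)
    fix A B assume AB: "closedin (top_of_set G) A \<and> closedin (top_of_set G) B \<and> A \<noteq> {} \<and> B \<noteq> {} \<and> A \<inter> B = {} \<and> G = A \<union> B"
      and n: "setdist A B \<noteq> 0"
    have "0 < setdist A B" using n setdist_pos_le[of A B] by linarith
    moreover have "saturated (setdist A B) G A"
      unfolding saturated_def using AB setdist_le_dist[of _ A _ B] by (auto simp: not_less[symmetric])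
    ultimately have "A = G" using * AB by blast
    then show False using AB by blast
  qed
qed

definition almost_component_of :: "'a::metric_space set \<Rightarrow> 'a \<Rightarrow> 'a set" where
  "almost_component_of S p = \<Union>{D. D \<subseteq> S \<and> almost_connected D \<and> p \<in> D}"

lemma almost_connected_Union:
  assumes "\<And>D. D \<in> \<D> \<Longrightarrow> almost_connected D" "\<And>D. D \<in> \<D> \<Longrightarrow> p \<in> D"
  shows "almost_connected (\<Union>\<D>)"
  unfolding almost_connected_iff
proof (intro allI impI)
  fix \<delta> :: real and B assume \<delta>: "0 < \<delta>" and B: "saturated \<delta> (\<Union>\<D>) B" "B \<noteq> {}"
  have whole: "D \<subseteq> B" if "D \<in> \<D>" "D \<inter> B \<noteq> {}" for D
  proof -
    have "saturated \<delta> D (D \<inter> B)" using B that by (auto simp: saturated_def)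
    then have "D \<inter> B = D" using assms(1)[OF that(1)] \<delta> that(2) unfolding almost_connected_iff by blast
    then show ?thesis by blast
  qed
  obtain D where D: "D \<in> \<D>" "D \<inter> B \<noteq> {}" using B unfolding saturated_def by blast
  then have "p \<in> B" using whole assms by blast
  then have "\<Union>\<D> \<subseteq> B" using whole assms by blast
  then show "B = \<Union>\<D>" using B by (auto simp: saturated_def)
qed

lemma almost_component_of_maximal:
  "D \<subseteq> S \<Longrightarrow> almost_connected D \<Longrightarrow> p \<in> D \<Longrightarrow> D \<subseteq> almost_component_of S p"
  by (auto simp: almost_component_of_def)

lemma almost_connected_almost_component_of: "almost_connected (almost_component_of S p)"
  unfolding almost_component_of_def by (rule almost_connected_Union) auto

lemma almost_component_of_subset: "almost_component_of S p \<subseteq> S"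
  by (auto simp: almost_component_of_def)

lemma almost_component_of_eq:
  assumes "q \<in> almost_component_of S p"
  shows "almost_component_of S q = almost_component_of S p"
proof
  obtain D where D: "D \<subseteq> S" "almost_connected D" "p \<in> D" "q \<in> D"
    using assms by (auto simp: almost_component_of_def)
  then have p: "p \<in> almost_component_of S q" using almost_component_of_maximal by blast
  show "almost_component_of S p \<subseteq> almost_component_of S q"
    by (rule almost_component_of_maximal[OF almost_component_of_subset almost_connected_almost_component_of assms])
  show "almost_component_of S q \<subseteq> almost_component_of S p"
    by (rule almost_component_of_maximal[OF almost_component_of_subset almost_connected_almost_component_of p])
qed

lemma almost_component_of_in_almost_components:
  assumes p: "p \<in> almost_component_of S p"
  shows "almost_component_of S p \<in> almost_components S"
proof -
  have "D = almost_component_of S p" if "almost_component_of S p \<subseteq> D" "D \<subseteq> S" "almost_connected D" for D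
    using almost_component_of_maximal[OF that(2,3), of p] that(1) p by blast
  then show ?thesis
    using almost_component_of_subset[of S p] almost_connected_almost_component_of[of S p]
    by (simp add: almost_components_def)
qed

text \<open>
Each \<open>G i\<close> lies in one almost component, namely that of any of its points. So an almost component is the
union of the \<open>G i\<close> that it meets, and the almost components of points are indexed by those \<open>i\<close> with nonempty \<open>G i\<close>.
\<close>

lemma almost_component_partition:
  assumes c: "countable I" and S: "S = (\<Union>i\<in>I. G i)" and G: "\<And>i. i \<in> I \<Longrightarrow> almost_connected (G i)"
  shows "\<exists>\<S>. countable \<S> \<and> S = \<Union>\<S> \<and> (\<forall>K\<in>\<S>. K \<in> almost_components S \<and>
    (\<exists>J. countable J \<and> J \<subseteq> I \<and> K = (\<Union>i\<in>J. G i)))"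
proof -
  have sub: "G i \<subseteq> almost_component_of S p" if "i \<in> I" "p \<in> G i" for i p
    using that S by (intro almost_component_of_maximal G) auto
  define \<S> where "\<S> = almost_component_of S ` S"
  have "\<S> \<subseteq> (\<lambda>i. almost_component_of S (SOME p. p \<in> G i)) ` I"
  proof
    fix K assume "K \<in> \<S>"
    then obtain p i where p: "K = almost_component_of S p" "i \<in> I" "p \<in> G i" unfolding \<S>_def using S by blast
    then have "(SOME p. p \<in> G i) \<in> G i" by (intro someI_ex[of "\<lambda>p. p \<in> G i"]) blast
    then have "(SOME p. p \<in> G i) \<in> almost_component_of S p" using sub p by blast
    then have "K = almost_component_of S (SOME p. p \<in> G i)" using almost_component_of_eq p(1) by blast
    then show "K \<in> (\<lambda>i. almost_component_of S (SOME p. p \<in> G i)) ` I" using p(2) by blast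
  qed
  then have "countable \<S>" using c by (meson countable_image countable_subset)
  moreover have self: "p \<in> almost_component_of S p" if "p \<in> S" for p using that S sub by blast
  then have "S = \<Union>\<S>" using almost_component_of_subset[of S] by (fastforce simp: \<S>_def)
  moreover have "K \<in> almost_components S \<and> (\<exists>J. countable J \<and> J \<subseteq> I \<and> K = (\<Union>i\<in>J. G i))" if K: "K \<in> \<S>" for K
  proof
    obtain p where p: "p \<in> S" "K = almost_component_of S p" using K by (auto simp: \<S>_def)
    show "K \<in> almost_components S" unfolding p(2) by (rule almost_component_of_in_almost_components[OF self[OF p(1)]])
    have "K = (\<Union>i\<in>{i\<in>I. G i \<inter> K \<noteq> {}}. G i)"
    proof
      show "K \<subseteq> (\<Union>i\<in>{i\<in>I. G i \<inter> K \<noteq> {}}. G i)"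
        using almost_component_of_subset[of S p] S p(2) by blast
      show "(\<Union>i\<in>{i\<in>I. G i \<inter> K \<noteq> {}}. G i) \<subseteq> K"
      proof (rule UN_least)
        fix i assume "i \<in> {i\<in>I. G i \<inter> K \<noteq> {}}"
        then obtain q where q: "i \<in> I" "q \<in> G i" "q \<in> K" by blast
        then show "G i \<subseteq> K" using sub[OF q(1,2)] almost_component_of_eq[of q S p] p(2) by simp
      qed
    qed
    moreover have "countable {i\<in>I. G i \<inter> K \<noteq> {}}" by (rule countable_subset[OF _ c]) auto
    ultimately show "\<exists>J. countable J \<and> J \<subseteq> I \<and> K = (\<Union>i\<in>J. G i)" by blast
  qed
  ultimately show ?thesis by blast
qed

section \<open>Minimizers and characteristics\<close>

locale C1_function =
  fixes g :: "real ^ 'n \<Rightarrow> real"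
  assumes C1: "C1_on g UNIV"
begin

lemma has_derivative_grad: "(g has_derivative (\<lambda>h. h \<bullet> grad g x)) (at x)"
proof -
  have "g differentiable (at x)" using C1 by (auto simp: C1_on_def)
  then obtain f' where f': "(g has_derivative f') (at x)" by (auto simp: differentiable_def)
  interpret bounded_linear f' using f' by (rule has_derivative_bounded_linear)
  have "f' h = h \<bullet> adjoint f' 1" for h
    using adjoint_works[OF linear_axioms, of h 1] by (simp add: inner_commute)
  then have D: "GDERIV g x :> adjoint f' 1"
    using f' unfolding gderiv_def by (metis (no_types, lifting) ext)
  have "D' = adjoint f' 1" if "GDERIV g x :> D'" for D'
  proof -
    have "(\<lambda>h. h \<bullet> D') = (\<lambda>h. h \<bullet> adjoint f' 1)"
      using that D unfolding gderiv_def by (rule has_derivative_unique)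
    then show ?thesis by (metis inner_commute vector_eq_ldot)
  qed
  then have "GDERIV g x :> grad g x"
    unfolding grad_def using D by (metis (no_types, lifting) theI)
  then show ?thesis unfolding gderiv_def .
qed

lemma continuous_grad: "continuous_on S (grad g)"
  using C1 continuous_on_subset unfolding C1_on_def by blast

lemma tendsto_grad: "(f \<longlongrightarrow> y) F \<Longrightarrow> ((\<lambda>k. grad g (f k)) \<longlongrightarrow> grad g y) F"
  using isCont_tendsto_compose[of y "grad g" f F] continuous_grad[of UNIV]
  by (simp add: continuous_on_eq_continuous_at)

lemma continuous_g: "continuous_on S g"
  by (meson continuous_at_imp_continuous_on has_derivative_continuous has_derivative_grad)

lemma tendsto_g: "(f \<longlongrightarrow> y) F \<Longrightarrow> ((\<lambda>k. g (f k)) \<longlongrightarrow> g y) F"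
  using isCont_tendsto_compose[of y g f F] continuous_g[of UNIV]
  by (simp add: continuous_on_eq_continuous_at)

lemma has_derivative_along_line:
  "((\<lambda>r. g (a + r *\<^sub>R v)) has_real_derivative v \<bullet> grad g (a + s *\<^sub>R v)) (at s)"
proof -
  have "((\<lambda>r. g (a + r *\<^sub>R v)) has_derivative (\<lambda>r. (r *\<^sub>R v) \<bullet> grad g (a + s *\<^sub>R v))) (at s)"
    by (rule has_derivative_compose[OF _ has_derivative_grad]) (auto intro!: derivative_eq_intros)
  then show ?thesis by (rule has_derivative_imp_has_field_derivative) simp
qed

lemma mean_value:
  obtains s where "0 < s" "s < 1" "g b - g a = (b - a) \<bullet> grad g (a + s *\<^sub>R (b - a))"
proof -
  have "\<exists>s. 0 < s \<and> s < 1 \<and> g (a + 1 *\<^sub>R (b - a)) - g (a + 0 *\<^sub>R (b - a))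
      = (1 - 0) * ((b - a) \<bullet> grad g (a + s *\<^sub>R (b - a)))"
    by (rule MVT2[OF zero_less_one]) (rule has_derivative_along_line)
  then show ?thesis using that by auto
qed

lemma minimizer_iff:
  "minimizer g (x, t) y \<longleftrightarrow> norm (y - x) \<le> t \<and> (\<forall>z. norm (z - x) \<le> t \<longrightarrow> g y \<le> g z)"
proof (cases "norm (y - x) \<le> t")
  case True
  have y: "y \<in> cball x t" using True by (simp add: dist_norm norm_minus_commute)
  have cpt: "compact (g ` cball x t)" by (intro compact_continuous_image continuous_g compact_cball)
  then have bdd: "bdd_below (g ` cball x t)" by (simp add: bounded_imp_bdd_below compact_imp_bounded)
  have "(INF z\<in>cball x t. g z) = g y \<longleftrightarrow> (\<forall>z\<in>cball x t. g y \<le> g z)"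
  proof
    assume "(INF z\<in>cball x t. g z) = g y"
    then show "\<forall>z\<in>cball x t. g y \<le> g z" using cINF_lower[OF bdd] by metis
  next
    assume "\<forall>z\<in>cball x t. g y \<le> g z"
    then show "(INF z\<in>cball x t. g z) = g y"
      using y by (intro cInf_eq_minimum) auto
  qed
  then show ?thesis using True
    by (auto simp: minimizer_def hopf_lax_def dist_norm norm_minus_commute)
qed (auto simp: minimizer_def)

lemma exists_minimizer: "0 \<le> t \<Longrightarrow> \<exists>y. minimizer g (x, t) y"
  using continuous_attains_inf[of "cball x t" g] continuous_g
  by (fastforce simp: minimizer_iff dist_norm norm_minus_commute)

lemma hopf_lax_minimizer: "minimizer g p y \<Longrightarrow> hopf_lax g p = g y"
  by (cases p) (auto simp: minimizer_def)

lemma hopf_lax_le: "norm (z - x) \<le> t \<Longrightarrow> hopf_lax g (x, t) \<le> g z"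
  by (metis exists_minimizer hopf_lax_minimizer minimizer_iff norm_ge_zero order_trans)

text \<open>
A competitor \<open>w\<close> for the limit point need not be admissible for the approximating points;
rescaling \<open>w - x'\<close> by the ratio of the radii makes it so.
\<close>

lemma minimizer_limit:
  assumes m: "\<And>k. minimizer g (x k, t k) (z k)"
    and x: "x \<longlonglongrightarrow> x'" and t: "t \<longlonglongrightarrow> t'" and z: "z \<longlonglongrightarrow> z'" 
  shows "minimizer g (x', t') z'"
  unfolding minimizer_iff
proof (intro conjI allI impI)
  show le: "norm (z' - x') \<le> t'"
  proof (rule LIMSEQ_le[OF _ t])
    show "(\<lambda>k. norm (z k - x k)) \<longlonglongrightarrow> norm (z' - x')" by (intro tendsto_intros x z)
    show "\<exists>N. \<forall>k\<ge>N. norm (z k - x k) \<le> t k" using m by (auto simp: minimizer_iff)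
  qed
  fix w assume w: "norm (w - x') \<le> t'"
  have t0: "0 \<le> t k" for k using m[of k] by (metis minimizer_iff norm_ge_zero order_trans)
  show "g z' \<le> g w"
  proof (cases "t' = 0")
    case True then show ?thesis using w le by simp
  next
    case False
    then have t'0: "0 < t'" using le norm_ge_zero[of "z' - x'"] by linarith
    define w' where "w' k = x k + (t k / t') *\<^sub>R (w - x')" for k
    have "w' \<longlonglongrightarrow> x' + (t' / t') *\<^sub>R (w - x')" unfolding w'_def
      by (intro tendsto_intros x t) (use False in auto)
    then have "w' \<longlonglongrightarrow> w" using False by simp
    moreover have "g (z k) \<le> g (w' k)" for k
    proof -
      have "norm (w' k - x k) = t k / t' * norm (w - x')"
        using t'0 t0[of k] by (simp add: w'_def)
      also have "\<dots> \<le> t k / t' * t'" using w t'0 t0[of k] by (intro mult_left_mono) auto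
      finally show ?thesis using m[of k] t'0 by (simp add: minimizer_iff)
    qed
    ultimately show ?thesis using LIMSEQ_le[OF tendsto_g[OF z] tendsto_g[of w']] by blast
  qed
qed

lemma minimizer_subsequence:
  assumes m: "\<And>k. minimizer g (q k) (z k)" and q: "q \<longlonglongrightarrow> p"
  obtains r z' where "strict_mono (r :: nat \<Rightarrow> nat)" "(z \<circ> r) \<longlonglongrightarrow> z'" "minimizer g p z'"
proof -
  obtain x t where p: "p = (x, t)" by (cases p)
  have x: "(\<lambda>k. fst (q k)) \<longlonglongrightarrow> x" and t: "(\<lambda>k. snd (q k)) \<longlonglongrightarrow> t"
    using tendsto_fst[OF q] tendsto_snd[OF q] p by auto
  have le: "norm (z k - fst (q k)) \<le> snd (q k)" for k
    using m[of k] by (metis minimizer_iff prod.collapse)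
  obtain b c where "\<And>k. norm (fst (q k)) \<le> b" "\<And>k. norm (snd (q k)) \<le> c"
    using x t by (metis BseqD convergentI convergent_imp_Bseq)
  then have "norm (z k) \<le> b + c" for k
    using le[of k] norm_triangle_sub[of "z k" "fst (q k)"] 
    by (smt (verit) real_norm_def)
  then have "bounded (range z)" by (auto simp: bounded_iff)
  then obtain z' r where r: "strict_mono (r :: nat \<Rightarrow> nat)" and z: "(z \<circ> r) \<longlonglongrightarrow> z'"
    using bounded_imp_convergent_subsequence by blast
  have "minimizer g (x, t) z'"
  proof (rule minimizer_limit[OF _ _ _ z])
    show "minimizer g ((fst \<circ> q \<circ> r) k, (snd \<circ> q \<circ> r) k) ((z \<circ> r) k)" for k using m by simp
    show "(fst \<circ> q \<circ> r) \<longlonglongrightarrow> x" "(snd \<circ> q \<circ> r) \<longlonglongrightarrow> t"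
      using LIMSEQ_subseq_LIMSEQ[OF x r] LIMSEQ_subseq_LIMSEQ[OF t r] by (simp_all add: o_def)
  qed
  then show ?thesis using that[OF r z] p by simp
qed

text \<open>
Upper semicontinuity of the set of minimizers, in the form that is used most: where the
minimizer is unique, all minimizers of nearby points are close to it.
\<close>

lemma minimizers_nearby:
  assumes V: "open V" "\<And>y. minimizer g p y \<Longrightarrow> y \<in> V"
  obtains \<rho> where "0 < \<rho>" "\<And>q z. dist q p < \<rho> \<Longrightarrow> minimizer g q z \<Longrightarrow> z \<in> V"
proof (rule ccontr)
  assume "\<not> thesis"
  then have "\<exists>q z. dist q p < inverse (Suc k) \<and> minimizer g q z \<and> z \<notin> V" for k
    using that[of "inverse (Suc k)"] by (metis inverse_positive_iff_positive of_nat_0_less_iff zero_less_Suc)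
  then obtain q z where q: "\<And>k. dist (q k) p < inverse (Suc k)"
    and m: "\<And>k. minimizer g (q k) (z k)" and z: "\<And>k. z k \<notin> V" by metis
  have "q \<longlonglongrightarrow> p"
    unfolding tendsto_dist_iff[of q]
    by (rule tendsto_sandwich[OF _ _ tendsto_const LIMSEQ_inverse_real_of_nat])
       (use q in \<open>auto intro!: always_eventually less_imp_le\<close>)
  then obtain r z' where "(z \<circ> r) \<longlonglongrightarrow> z'" "minimizer g p z'"
    by (rule minimizer_subsequence[OF m]) 
  moreover have "z' \<in> - V"
    by (rule closed_sequentially[of "- V" "z \<circ> r"]) (use V z \<open>(z \<circ> r) \<longlonglongrightarrow> z'\<close> in auto)
  ultimately show False using V by auto
qed

text \<open>
The direction of the characteristic through \<open>y\<close>; its value is \<open>0\<close> at critical points of \<open>g\<close>.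
\<close>

definition nu :: "real ^ 'n \<Rightarrow> real ^ 'n" where
  "nu y = grad g y /\<^sub>R norm (grad g y)"

lemma char_line_nu: "char_line g y t = y + t *\<^sub>R nu y"
  by (simp add: char_line_def nu_def)

lemma norm_nu: "grad g y \<noteq> 0 \<Longrightarrow> norm (nu y) = 1"
  by (simp add: nu_def)

lemma tendsto_nu: "(f \<longlongrightarrow> y) F \<Longrightarrow> grad g y \<noteq> 0 \<Longrightarrow> ((\<lambda>k. nu (f k)) \<longlongrightarrow> nu y) F"
  unfolding nu_def by (intro tendsto_intros tendsto_grad) auto

lemma continuous_nu: "(\<And>y. y \<in> S \<Longrightarrow> grad g y \<noteq> 0) \<Longrightarrow> continuous_on S nu"
  unfolding nu_def by (intro continuous_intros continuous_grad) auto

lemma minimizer_first_order: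
  assumes m: "minimizer g (x, t) y" and w: "norm (w - x) \<le> t"
  shows "0 \<le> (w - y) \<bullet> grad g y"
proof (rule ccontr)
  assume "\<not> 0 \<le> (w - y) \<bullet> grad g y"
  then have "(w - y) \<bullet> grad g (y + 0 *\<^sub>R (w - y)) < 0" by simp
  from has_real_derivative_neg_dec_right[OF has_field_derivative_at_within[OF has_derivative_along_line] this,
      of UNIV]
  obtain d where d: "0 < d" "\<And>h. 0 < h \<Longrightarrow> h < d \<Longrightarrow> g (y + h *\<^sub>R (w - y)) < g y"
    by auto
  define h where "h = min 1 (d / 2)"
  have h: "0 < h" "h \<le> 1" "h < d" using d by (auto simp: h_def)
  have "y \<in> cball x t" "w \<in> cball x t" using m w
    by (auto simp: minimizer_iff dist_norm norm_minus_commute)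
  then have "(1 - h) *\<^sub>R y + h *\<^sub>R w \<in> cball x t" using h
    by (intro convexD) auto
  then have "norm (y + h *\<^sub>R (w - y) - x) \<le> t"
    by (simp add: dist_norm norm_minus_commute algebra_simps)
  then show False using m d(2)[of h] h by (auto simp: minimizer_iff)
qed

text \<open>
Take for \<open>w\<close> in the first order condition the point of the ball farthest in the direction \<open>- nu y\<close>.
The condition becomes \<open>t \<le> (x - y) \<bullet> nu y\<close>, which is the equality case of Cauchy-Schwarz because
\<open>norm (x - y) \<le> t\<close>.
\<close>

lemma minimizer_on_char_line:
  assumes m: "minimizer g (x, t) y" and D: "grad g y \<noteq> 0"
  shows "x = char_line g y t"
proof -
  have t: "0 \<le> t" using m by (metis minimizer_iff norm_ge_zero order_trans)
  have "0 \<le> (x - t *\<^sub>R nu y - y) \<bullet> grad g y"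
    by (rule minimizer_first_order[OF m]) (use t norm_nu[OF D] in simp)
  moreover have "grad g y = norm (grad g y) *\<^sub>R nu y" using D by (simp add: nu_def)
  ultimately have "0 \<le> norm (grad g y) * ((x - t *\<^sub>R nu y - y) \<bullet> nu y)"
    by (metis inner_scaleR_right)
  then have "0 \<le> (x - t *\<^sub>R nu y - y) \<bullet> nu y" using D by (simp add: zero_le_mult_iff)
  moreover have nn: "nu y \<bullet> nu y = 1" using norm_nu[OF D] by (simp add: dot_square_norm)
  ultimately have 1: "t \<le> (x - y) \<bullet> nu y" by (simp add: algebra_simps)
  have "norm (x - y) \<le> t" using m by (simp add: minimizer_iff norm_minus_commute)
  then have 2: "(x - y) \<bullet> (x - y) \<le> t\<^sup>2" by (metis dot_square_norm norm_ge_zero power_mono)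
  have "(norm (x - y - t *\<^sub>R nu y))\<^sup>2 = (x - y) \<bullet> (x - y) - 2 * t * ((x - y) \<bullet> nu y) + t\<^sup>2 * (nu y \<bullet> nu y)"
    unfolding power2_norm_eq_inner
    by (simp add: inner_diff_left inner_diff_right inner_commute power2_eq_square algebra_simps)
  also have "\<dots> \<le> 0" using 2 mult_left_mono[OF 1 t] nn by (simp add: power2_eq_square)
  finally have "x - y - t *\<^sub>R nu y = 0" by simp
  then show ?thesis by (simp add: char_line_nu algebra_simps)
qed

text \<open>
The ball around \<open>char_line g y t\<close> of radius \<open>t\<close> is tangent to the level set at \<open>y\<close>. In this form it
is visible how the ball grows with \<open>t\<close>: the scalar product is positive for all its points \<open>z\<close> other than \<open>y\<close>.
\<close>

lemma cball_char_line:
  assumes "grad g y \<noteq> 0" "0 \<le> t"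
  shows "norm (z - char_line g y t) \<le> t \<longleftrightarrow> (z - y) \<bullet> (z - y) \<le> 2 * t * ((z - y) \<bullet> nu y)"
proof -
  have nn: "nu y \<bullet> nu y = 1" using norm_nu assms by (simp add: dot_square_norm)
  have "norm (z - char_line g y t) \<le> t \<longleftrightarrow> (norm (z - char_line g y t))\<^sup>2 \<le> t\<^sup>2"
    using assms(2) by (metis norm_ge_zero power2_le_imp_le power_mono)
  also have "(norm (z - char_line g y t))\<^sup>2 = (norm ((z - y) - t *\<^sub>R nu y))\<^sup>2"
    by (simp add: char_line_nu diff_diff_eq)
  also have "\<dots> = (z - y) \<bullet> (z - y) - 2 * t * ((z - y) \<bullet> nu y) + t\<^sup>2 * (nu y \<bullet> nu y)"
    unfolding power2_norm_eq_inner by (simp add: inner_diff_left inner_diff_right inner_commute power2_eq_square)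
  finally show ?thesis using nn by auto
qed

lemma minimizer_char_line_iff:
  assumes "grad g y \<noteq> 0" "0 \<le> t"
  shows "minimizer g (char_line g y t, t) y \<longleftrightarrow>
    (\<forall>z. (z - y) \<bullet> (z - y) \<le> 2 * t * ((z - y) \<bullet> nu y) \<longrightarrow> g y \<le> g z)"
  unfolding minimizer_iff cball_char_line[OF assms] by simp

lemma tangent_ball_mono:
  assumes "0 \<le> s" "s \<le> t" "(z - y) \<bullet> (z - y) \<le> 2 * s * ((z - y) \<bullet> nu y)"
  shows "(z - y) \<bullet> (z - y) \<le> 2 * t * ((z - y) \<bullet> nu y)"
proof (cases "s = 0")
  case True
  then have "(z - y) \<bullet> (z - y) \<le> 0" using assms(3) by simp
  then have "z = y" by (metis inner_gt_zero_iff not_le right_minus_eq)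
  then show ?thesis by simp
next
  case False
  have "0 \<le> 2 * s * ((z - y) \<bullet> nu y)" using assms(3) inner_ge_zero order_trans by blast
  then have "0 \<le> (z - y) \<bullet> nu y" using assms False by (simp add: zero_le_mult_iff)
  then have "2 * s * ((z - y) \<bullet> nu y) \<le> 2 * t * ((z - y) \<bullet> nu y)" using assms by (intro mult_right_mono) auto
  then show ?thesis using assms by linarith
qed

lemma tangent_ball_strict_mono:
  assumes "0 \<le> s" "s < t" "(z - y) \<bullet> (z - y) \<le> 2 * s * ((z - y) \<bullet> nu y)" "z \<noteq> y"
  shows "(z - y) \<bullet> (z - y) < 2 * t * ((z - y) \<bullet> nu y)"
proof -
  have "0 < (z - y) \<bullet> (z - y)" using assms by simp
  then have "0 < 2 * s * ((z - y) \<bullet> nu y)" using assms(3) by linarith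
  then have "0 < (z - y) \<bullet> nu y" using assms(1) by (simp add: zero_less_mult_iff)
  then have "2 * s * ((z - y) \<bullet> nu y) < 2 * t * ((z - y) \<bullet> nu y)" using assms by (intro mult_strict_right_mono) auto
  then show ?thesis using assms by linarith
qed

lemma minimizer_char_line_mono:
  assumes "grad g y \<noteq> 0" "0 \<le> s" "s \<le> t" "minimizer g (char_line g y t, t) y"
  shows "minimizer g (char_line g y s, s) y"
  using assms tangent_ball_mono[of s t] by (simp add: minimizer_char_line_iff)

lemma unique_minimizer_char_line_mono:
  assumes "grad g y \<noteq> 0" "0 \<le> s" "s \<le> t" "unique_minimizer g (char_line g y t, t) y"
  shows "unique_minimizer g (char_line g y s, s) y"
proof -
  have t: "minimizer g (char_line g y t, t) y" using assms by (simp add: unique_minimizer_def)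
  have s: "minimizer g (char_line g y s, s) y" using minimizer_char_line_mono assms t by blast
  have "z = y" if "minimizer g (char_line g y s, s) z" for z
  proof -
    have "g z = g y" using that s hopf_lax_minimizer by metis
    moreover have "norm (z - char_line g y t) \<le> t"
      using that assms tangent_ball_mono[of s t z y] cball_char_line[of y s z] cball_char_line[of y t z] by (auto simp: minimizer_iff)
    ultimately have "minimizer g (char_line g y t, t) z" using t by (simp add: minimizer_iff)
    then show ?thesis using assms by (simp add: unique_minimizer_def)
  qed
  then show ?thesis using s by (simp add: unique_minimizer_def)
qed

section \<open>Points where the solution is not differentiable\<close>

text \<open>
For \<open>C = UNIV\<close> this is the singular set (\<open>singular_set_eq\<close>); if the gradient does not vanish on \<open>C\<close>,
it is \<open>T(C)\<close> without the points that have a unique minimizer (\<open>T_set_minus_unique\<close>).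
\<close>

definition singular_points :: "(real ^ 'n) set \<Rightarrow> ((real ^ 'n) \<times> real) set" where
  "singular_points C = {(x, t). 0 < t \<and> (x, t) \<notin> unique_minimizer_set g \<and>
     (\<exists>y\<in>C. grad g y \<noteq> 0 \<and> minimizer g (x, t) y)}"

lemma minimizer_gradient_direction:
  assumes "minimizer g (x, t) y" "grad g y \<noteq> 0" "0 < t"
  shows "y = x - t *\<^sub>R nu y"
  using minimizer_on_char_line[OF assms(1,2)] by (simp add: char_line_nu)

text \<open>
With \<open>w = (y - x) / t\<close> the function \<open>(x', t') \<mapsto> g (x' + t' w)\<close> lies above the solution and touches it
at \<open>(x, t)\<close>, so both have the same derivative there.
\<close>

lemma derivative_at_minimizer:
  assumes t: "0 < t" and m: "minimizer g (x, t) y"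
    and L: "(hopf_lax g has_derivative L) (at (x, t))"
  shows "L (h, s) = (h + s *\<^sub>R ((y - x) /\<^sub>R t)) \<bullet> grad g y"
proof -
  define w where "w = (y - x) /\<^sub>R t"
  have w1: "norm w \<le> 1" using m t
    by (simp add: w_def minimizer_iff inverse_eq_divide)
  have y: "x + t *\<^sub>R w = y" using t by (simp add: w_def)
  define f where "f q = g (fst q + snd q *\<^sub>R w) - hopf_lax g q" for q
  have "((\<lambda>q. fst q + snd q *\<^sub>R w) has_derivative (\<lambda>q. fst q + snd q *\<^sub>R w)) (at (x, t))"
    by (auto intro!: derivative_eq_intros)
  from has_derivative_compose[OF this has_derivative_grad]
  have "((\<lambda>q. g (fst q + snd q *\<^sub>R w)) has_derivative (\<lambda>q. (fst q + snd q *\<^sub>R w) \<bullet> grad g y)) (at (x, t))"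
    by (simp add: y)
  then have D: "(f has_derivative (\<lambda>q. (fst q + snd q *\<^sub>R w) \<bullet> grad g y - L q)) (at (x, t))"
    unfolding f_def by (intro has_derivative_diff L)
  have "f (x, t) = 0" using m y by (simp add: f_def hopf_lax_minimizer)
  moreover have "0 \<le> f q" if "q \<in> {q. 0 < snd q}" for q
  proof -
    have "norm (snd q *\<^sub>R w) \<le> snd q" using that w1 by (simp add: mult_left_le)
    then show ?thesis using hopf_lax_le[of "fst q + snd q *\<^sub>R w" "fst q" "snd q"] by (simp add: f_def)
  qed
  moreover have "open {q :: (real^'n) \<times> real. 0 < snd q}" by (intro open_Collect_less continuous_intros)
  ultimately have "(\<lambda>q. (fst q + snd q *\<^sub>R w) \<bullet> grad g y - L q) = (\<lambda>q. 0)"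
    using t by (intro differential_zero_maxmin[OF _ _ D]) auto
  from fun_cong[OF this, of "(h, s)"] show ?thesis by (simp add: w_def)
qed

text \<open>
For the lower estimate of the solution near \<open>(x, t)\<close>: all minimizers of nearby points, and all points \<open>\<xi>\<close>
close to these, see almost the common first order data \<open>p\<close> and \<open>c\<close> of the minimizers of \<open>(x, t)\<close>.
\<close>

lemma minimizer_gradient_bound:
  assumes t: "0 < t" and e: "0 < e"
    and m: "\<And>y. minimizer g (x, t) y \<Longrightarrow> grad g y = p \<and> ((y - x) /\<^sub>R t) \<bullet> p = c"
  shows "\<exists>d>0. \<forall>q z \<xi>. dist q (x, t) < d \<longrightarrow> minimizer g q z \<longrightarrow> dist \<xi> z \<le> 2 * dist q (x, t) \<longrightarrow>
    norm (grad g \<xi> - p) < e \<and> \<bar>((z - fst q) /\<^sub>R snd q) \<bullet> grad g \<xi> - c\<bar> < e"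
    (is "\<exists>d>0. \<forall>q z \<xi>. ?A d q \<longrightarrow> ?B q z \<longrightarrow> ?C q z \<xi> \<longrightarrow> ?P q z \<xi>")
proof (rule ccontr)
  assume "\<not> ?thesis"
  then have "\<forall>d>0. \<exists>q z \<xi>. ?A d q \<and> ?B q z \<and> ?C q z \<xi> \<and> \<not> ?P q z \<xi>" by blast
  then have "\<exists>q z \<xi>. ?A (inverse (Suc k)) q \<and> ?B q z \<and> ?C q z \<xi> \<and> \<not> ?P q z \<xi>" for k
    by (metis inverse_positive_iff_positive of_nat_0_less_iff zero_less_Suc)
  then obtain q z \<xi> where q: "\<And>k. ?A (inverse (Suc k)) (q k)"
    and z: "\<And>k. ?B (q k) (z k)" and \<xi>: "\<And>k. ?C (q k) (z k) (\<xi> k)" and n: "\<And>k. \<not> ?P (q k) (z k) (\<xi> k)"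
    by metis
  have qd: "(\<lambda>k. dist (q k) (x, t)) \<longlonglongrightarrow> 0"
    by (rule tendsto_sandwich[OF _ _ tendsto_const LIMSEQ_inverse_real_of_nat])
       (use q in \<open>auto intro!: always_eventually less_imp_le\<close>)
  then have ql: "q \<longlonglongrightarrow> (x, t)" using tendsto_dist_iff by blast
  obtain r y where r: "strict_mono r" and zl: "(z \<circ> r) \<longlonglongrightarrow> y" and y: "minimizer g (x, t) y"
    by (rule minimizer_subsequence[OF z ql])
  have ql: "(\<lambda>k. q (r k)) \<longlonglongrightarrow> (x, t)" using LIMSEQ_subseq_LIMSEQ[OF ql r] by (simp add: o_def)
  have qd: "(\<lambda>k. dist (q (r k)) (x, t)) \<longlonglongrightarrow> 0" using LIMSEQ_subseq_LIMSEQ[OF qd r] by (simp add: o_def)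
  have zl: "(\<lambda>k. z (r k)) \<longlonglongrightarrow> y" using zl by (simp add: o_def)
  have "(\<lambda>k. dist (\<xi> (r k)) (z (r k))) \<longlonglongrightarrow> 0"
    by (rule tendsto_sandwich[OF _ _ tendsto_const tendsto_mult_right_zero[OF qd, of 2]])
       (use \<xi> in \<open>auto intro!: always_eventually\<close>)
  then have "(\<lambda>k. \<xi> (r k) - z (r k)) \<longlonglongrightarrow> 0" by (subst tendsto_norm_zero_iff[symmetric]) (simp add: dist_norm)
  from tendsto_add[OF this zl] have \<xi>l: "(\<lambda>k. \<xi> (r k)) \<longlonglongrightarrow> y" by simp
  have gl: "(\<lambda>k. grad g (\<xi> (r k))) \<longlonglongrightarrow> grad g y" by (rule tendsto_grad[OF \<xi>l])
  then have "(\<lambda>k. norm (grad g (\<xi> (r k)) - p)) \<longlonglongrightarrow> norm (grad g y - p)" by (intro tendsto_intros)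
  then have 1: "\<forall>\<^sub>F k in sequentially. norm (grad g (\<xi> (r k)) - p) < e"
    using m[OF y] e by (intro order_tendstoD(2)) auto
  have "(\<lambda>k. \<bar>((z (r k) - fst (q (r k))) /\<^sub>R snd (q (r k))) \<bullet> grad g (\<xi> (r k)) - c\<bar>)
      \<longlonglongrightarrow> \<bar>((y - fst (x, t)) /\<^sub>R snd (x, t)) \<bullet> grad g y - c\<bar>"
    using t by (intro tendsto_intros zl ql gl) auto
  then have 2: "\<forall>\<^sub>F k in sequentially. \<bar>((z (r k) - fst (q (r k))) /\<^sub>R snd (q (r k))) \<bullet> grad g (\<xi> (r k)) - c\<bar> < e"
    using m[OF y] e by (intro order_tendstoD(2)) auto
  from 1 2 have "\<forall>\<^sub>F k in sequentially. False" by eventually_elim (use n in blast)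
  then show False by simp
qed

text \<open>
The solution is the minimum over \<open>w\<close> in the unit ball of the \<open>C\<^sup>1\<close> functions
\<open>(x', t') \<mapsto> g (x' + t' w)\<close>. If those that attain the minimum at \<open>(x, t)\<close> have the same derivative, the minimum
is differentiable.
\<close>

lemma hopf_lax_has_derivative:
  assumes t: "0 < t"
    and m: "\<And>y. minimizer g (x, t) y \<Longrightarrow> grad g y = p \<and> ((y - x) /\<^sub>R t) \<bullet> p = c"
  shows "(hopf_lax g has_derivative (\<lambda>q. fst q \<bullet> p + snd q * c)) (at (x, t))"
  unfolding has_derivative_at_alt
proof (intro conjI allI impI)
  show "bounded_linear (\<lambda>q. fst q \<bullet> p + snd q * c)"
    by (intro bounded_linear_add bounded_linear_fst[THEN bounded_linear_inner_left_comp]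
        bounded_linear_snd[THEN bounded_linear_mult_const])
  fix e :: real assume e: "0 < e"
  obtain y where y: "minimizer g (x, t) y" using exists_minimizer t by (meson less_imp_le)
  define w where "w = (y - x) /\<^sub>R t"
  have w1: "norm w \<le> 1" using y t by (simp add: w_def minimizer_iff inverse_eq_divide)
  have yw: "x + t *\<^sub>R w = y" using t by (simp add: w_def)
  have wp: "w \<bullet> p = c" "grad g y = p" using m[OF y] by (auto simp: w_def)
  have "((\<lambda>q. fst q + snd q *\<^sub>R w) has_derivative (\<lambda>q. fst q + snd q *\<^sub>R w)) (at (x, t))"
    by (auto intro!: derivative_eq_intros)
  from has_derivative_compose[OF this has_derivative_grad]
  have "((\<lambda>q. g (fst q + snd q *\<^sub>R w)) has_derivative (\<lambda>q. fst q \<bullet> p + snd q * c)) (at (x, t))"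
    by (simp add: yw wp inner_add_left)
  then obtain d1 where d1: "0 < d1" "\<And>q. norm (q - (x, t)) < d1 \<Longrightarrow>
      norm (g (fst q + snd q *\<^sub>R w) - g y - (fst (q - (x, t)) \<bullet> p + snd (q - (x, t)) * c)) \<le> e * norm (q - (x, t))"
    unfolding has_derivative_at_alt using e by (fastforce simp: yw)
  obtain d2 where d2: "0 < d2" "\<And>q z \<xi>. dist q (x, t) < d2 \<Longrightarrow> minimizer g q z \<Longrightarrow> dist \<xi> z \<le> 2 * dist q (x, t) \<Longrightarrow>
    norm (grad g \<xi> - p) < e / 2 \<and> \<bar>((z - fst q) /\<^sub>R snd q) \<bullet> grad g \<xi> - c\<bar> < e / 2"
    using minimizer_gradient_bound[OF t _ m, of "e / 2"] e by (metis half_gt_zero)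
  show "\<exists>d>0. \<forall>q. norm (q - (x, t)) < d \<longrightarrow>
      norm (hopf_lax g q - hopf_lax g (x, t) - (fst (q - (x, t)) \<bullet> p + snd (q - (x, t)) * c)) \<le> e * norm (q - (x, t))"
  proof (intro exI[of _ "min t (min d1 d2)"] conjI allI impI)
    show "0 < min t (min d1 d2)" using t d1 d2 by simp
    fix q assume q: "norm (q - (x, t)) < min t (min d1 d2)"
    obtain x' t' where q': "q = (x', t')" by (cases q)
    have hs: "norm (x' - x) \<le> norm (q - (x, t))" "\<bar>t' - t\<bar> \<le> norm (q - (x, t))"
      using norm_fst_le[of "x' - x" "t' - t"] norm_snd_le[of "t' - t" "x' - x"] by (simp_all add: q')
    then have t': "0 < t'" using q by auto
    have u: "hopf_lax g (x, t) = g y" by (rule hopf_lax_minimizer[OF y])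
    have "norm (t' *\<^sub>R w) \<le> t'" using w1 t' by (simp add: mult_left_le)
    then have "hopf_lax g q \<le> g (x' + t' *\<^sub>R w)"
      unfolding q' by (intro hopf_lax_le) simp
    then have upper: "hopf_lax g q - hopf_lax g (x, t) - ((x' - x) \<bullet> p + (t' - t) * c) \<le> e * norm (q - (x, t))"
      using d1(2)[of q] q u by (simp add: q')
    obtain z where z: "minimizer g (x', t') z" using exists_minimizer t' by (meson less_imp_le)
    define w' where "w' = (z - x') /\<^sub>R t'"
    have w'1: "norm w' \<le> 1" using z t' by (simp add: w'_def minimizer_iff inverse_eq_divide)
    have zw': "z = x' + t' *\<^sub>R w'" using t' by (simp add: w'_def)
    \<comment> \<open>the minimizer at \<open>(x', t')\<close> gives the competitor with the same \<open>w'\<close> at \<open>(x, t)\<close>\<close>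
    define a where "a = x + t *\<^sub>R w'"
    have za: "z - a = (x' - x) + (t' - t) *\<^sub>R w'" by (simp add: zw' a_def algebra_simps)
    have "norm (t *\<^sub>R w') \<le> t" using w'1 t by (simp add: mult_left_le)
    then have la: "hopf_lax g (x, t) \<le> g a" unfolding a_def by (intro hopf_lax_le) simp
    obtain r where r: "0 < r" "r < 1" and gr: "g z - g a = (z - a) \<bullet> grad g (a + r *\<^sub>R (z - a))"
      by (rule mean_value)
    define \<xi> where "\<xi> = a + r *\<^sub>R (z - a)"
    have "\<xi> - z = (1 - r) *\<^sub>R (a - z)" by (simp add: \<xi>_def algebra_simps)
    then have "dist \<xi> z = (1 - r) * norm (z - a)" using r by (simp add: dist_norm norm_minus_commute)
    also have "\<dots> \<le> norm (z - a)" using r by (simp add: mult_left_le_one_le)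
    also have "\<dots> \<le> norm (x' - x) + norm ((t' - t) *\<^sub>R w')" unfolding za by (rule norm_triangle_ineq)
    also have "\<dots> \<le> norm (x' - x) + \<bar>t' - t\<bar>" using w'1 by (simp add: mult_left_le)
    also have "\<dots> \<le> 2 * dist q (x, t)" using hs by (simp add: dist_norm)
    finally have "dist \<xi> z \<le> 2 * dist q (x, t)" .
    then have \<xi>: "norm (grad g \<xi> - p) < e / 2" "\<bar>w' \<bullet> grad g \<xi> - c\<bar> < e / 2"
      using d2(2)[of q z \<xi>] q z by (auto simp: q' w'_def dist_norm)
    have "g z - g a - ((x' - x) \<bullet> p + (t' - t) * c)
        = (x' - x) \<bullet> (grad g \<xi> - p) + (t' - t) * (w' \<bullet> grad g \<xi> - c)"
      using gr unfolding \<xi>_def[symmetric] unfolding za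
      by (simp add: inner_add_left inner_diff_right right_diff_distrib)
    also have "\<bar>\<dots>\<bar> \<le> norm (x' - x) * norm (grad g \<xi> - p) + \<bar>t' - t\<bar> * \<bar>w' \<bullet> grad g \<xi> - c\<bar>"
      using Cauchy_Schwarz_ineq2[of "x' - x" "grad g \<xi> - p"] abs_mult[of "t' - t" "w' \<bullet> grad g \<xi> - c"]
      by linarith
    also have "\<dots> \<le> norm (q - (x, t)) * (e / 2) + norm (q - (x, t)) * (e / 2)"
      using hs \<xi> by (intro add_mono mult_mono) auto
    finally have "\<bar>g z - g a - ((x' - x) \<bullet> p + (t' - t) * c)\<bar> \<le> e * norm (q - (x, t))" by simp
    moreover have "hopf_lax g q = g z" unfolding q' by (rule hopf_lax_minimizer[OF z])
    ultimately show "norm (hopf_lax g q - hopf_lax g (x, t) - (fst (q - (x, t)) \<bullet> p + snd (q - (x, t)) * c))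
        \<le> e * norm (q - (x, t))"
      using upper la by (auto simp: q')
  qed
qed

text \<open>
Two minimizers with the same nonzero gradient coincide, as \<open>y = x - t *\<^sub>R nu y\<close>; so in the presence of two
minimizers, one of them not critical, the derivative at \<open>(x, t)\<close> would take two values. In all other cases
the minimizers have the same first order data: there is just one, or all are critical.
\<close>

lemma singular_set_eq: "singular_set g = singular_points UNIV"
proof (intro equalityI subsetI)
  fix q assume "q \<in> singular_set g"
  then obtain x t where q: "q = (x, t)" and t: "0 < t" and nd: "\<not> hopf_lax g differentiable (at (x, t))"
    by (auto simp: singular_set_def)
  have "\<exists>y. grad g y \<noteq> 0 \<and> minimizer g (x, t) y"
  proof (rule ccontr)
    assume "\<not> ?thesis"
    then have "(hopf_lax g has_derivative (\<lambda>q. fst q \<bullet> 0 + snd q * 0)) (at (x, t))"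
      by (intro hopf_lax_has_derivative[OF t]) auto
    then show False using nd by (auto simp: differentiable_def)
  qed
  moreover have "(x, t) \<notin> unique_minimizer_set g"
  proof
    assume "(x, t) \<in> unique_minimizer_set g"
    then obtain y where "unique_minimizer g (x, t) y" by (auto simp: unique_minimizer_set_def)
    then have "(hopf_lax g has_derivative (\<lambda>q. fst q \<bullet> grad g y + snd q * (((y - x) /\<^sub>R t) \<bullet> grad g y))) (at (x, t))"
      by (intro hopf_lax_has_derivative[OF t]) (auto simp: unique_minimizer_def)
    then show False using nd by (auto simp: differentiable_def)
  qed
  ultimately show "q \<in> singular_points UNIV" using t q by (auto simp: singular_points_def)
next
  fix q assume "q \<in> singular_points UNIV"
  then obtain x t y where q: "q = (x, t)" and t: "0 < t" and n: "(x, t) \<notin> unique_minimizer_set g"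
    and y: "grad g y \<noteq> 0" "minimizer g (x, t) y" by (auto simp: singular_points_def)
  then obtain z where z: "minimizer g (x, t) z" "z \<noteq> y"
    by (auto simp: unique_minimizer_set_def unique_minimizer_def)
  have "\<not> (hopf_lax g has_derivative L) (at (x, t))" for L
  proof
    assume L: "(hopf_lax g has_derivative L) (at (x, t))"
    have "h \<bullet> grad g y = h \<bullet> grad g z" for h
      using derivative_at_minimizer[OF t y(2) L, of h 0] derivative_at_minimizer[OF t z(1) L, of h 0] by simp
    then have "grad g y = grad g z" by (metis inner_commute vector_eq_ldot)
    then have "nu y = nu z" "grad g z \<noteq> 0" using y by (auto simp: nu_def)
    then show False using minimizer_gradient_direction y z t by metis
  qed
  then show "q \<in> singular_set g" using q t by (auto simp: singular_set_def differentiable_def)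
qed

section \<open>The sets T, M, E and F\<close>

lemma minimizer_char_line_0: "grad g y \<noteq> 0 \<Longrightarrow> unique_minimizer g (char_line g y 0, 0) y"
  by (auto simp: unique_minimizer_def minimizer_iff char_line_nu)

lemma minimizer_char_line_left_limit:
  assumes t: "0 < t" and m: "\<And>s. 0 < s \<Longrightarrow> s < t \<Longrightarrow> minimizer g (char_line g y s, s) y"
  shows "minimizer g (char_line g y t, t) y"
proof -
  define s where "s k = t - t * inverse (Suc (Suc k))" for k :: nat
  have st: "s \<longlonglongrightarrow> t - t * 0" unfolding s_def
    by (intro tendsto_intros LIMSEQ_Suc[OF LIMSEQ_inverse_real_of_nat])
  have "0 < s k" "s k < t" for k using t by (auto simp: s_def field_simps add_pos_nonneg)
  then have "minimizer g (char_line g y (s k), s k) y" for k using m by blast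
  then show ?thesis
    by (rule minimizer_limit[where z = "\<lambda>k. y"])
       (use st in \<open>auto simp: char_line_nu intro!: tendsto_intros\<close>)
qed

lemma le_ts_iff:
  assumes y: "grad g y \<noteq> 0" and t: "0 < t"
  shows "ennreal t \<le> ts g y \<longleftrightarrow> minimizer g (char_line g y t, t) y"
proof
  assume le: "ennreal t \<le> ts g y"
  show "minimizer g (char_line g y t, t) y"
  proof (rule minimizer_char_line_left_limit[OF t], rule ccontr)
    fix s assume s: "0 < s" "s < t" "\<not> minimizer g (char_line g y s, s) y"
    then have "ts g y \<le> ennreal s" unfolding ts_def by (intro INF_lower) auto
    then have "ennreal t \<le> ennreal s" using le by (rule order_trans[rotated])
    then show False using s by simp
  qed
next
  assume m: "minimizer g (char_line g y t, t) y"
  show "ennreal t \<le> ts g y" unfolding ts_def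
  proof (rule INF_greatest)
    fix s assume "s \<in> {t. 0 < t \<and> \<not> minimizer g (char_line g y t, t) y}"
    then have "0 < s" "\<not> minimizer g (char_line g y s, s) y" by auto
    then have "t \<le> s" using minimizer_char_line_mono[OF y _ _ m, of s] by linarith
    then show "ennreal t \<le> ennreal s" by (rule ennreal_leI)
  qed
qed

lemma ts_bar_le:
  assumes y: "grad g y \<noteq> 0" and t: "0 < t" and n: "\<not> unique_minimizer g (char_line g y t, t) y"
  shows "ts_bar g y \<le> ennreal t"
  unfolding ts_bar_def
proof (rule SUP_least)
  fix s assume "s \<in> {t. 0 < t \<and> unique_minimizer g (char_line g y t, t) y}"
  then have "0 < s" and u: "unique_minimizer g (char_line g y s, s) y" by auto
  have "s \<le> t"
  proof (rule ccontr)
    assume "\<not> s \<le> t"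
    then show False using unique_minimizer_char_line_mono[OF y _ _ u, of t] n t by simp
  qed
  then show "ennreal s \<le> ennreal t" by (rule ennreal_leI)
qed

lemma singular_pointsE:
  assumes "p \<in> singular_points S"
  obtains y t where "y \<in> S" "0 < t" "grad g y \<noteq> 0" "p = (char_line g y t, t)"
    "minimizer g (char_line g y t, t) y" "\<not> unique_minimizer g (char_line g y t, t) y"
proof -
  obtain x t y where p: "p = (x, t)" "0 < t" "p \<notin> unique_minimizer_set g" "y \<in> S" "grad g y \<noteq> 0"
    "minimizer g (x, t) y" using assms by (auto simp: singular_points_def)
  moreover have "x = char_line g y t" using p by (intro minimizer_on_char_line)
  ultimately show ?thesis using that[of y t] by (auto simp: unique_minimizer_set_def)
qed

lemma singular_pointsI:
  assumes "y \<in> S" "0 < t" "grad g y \<noteq> 0" "minimizer g (char_line g y t, t) y"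
    "\<not> unique_minimizer g (char_line g y t, t) y"
  shows "(char_line g y t, t) \<in> singular_points S"
  using assms by (auto simp: singular_points_def unique_minimizer_set_def unique_minimizer_def)

text \<open>
For positive \<open>t\<close>, \<open>t \<le> ts g y\<close> says that \<open>y\<close> is still a minimizer, and \<open>ts_bar g y \<le> t\<close> holds
when it is not the only one. The points of \<open>T\<close> with \<open>t = 0\<close> have a unique minimizer and drop out.
\<close>

lemma T_set_minus_unique:
  assumes S: "\<And>y. y \<in> S \<Longrightarrow> grad g y \<noteq> 0"
  shows "T_set g S - unique_minimizer_set g = singular_points S"
proof (intro equalityI subsetI)
  fix p assume p: "p \<in> T_set g S - unique_minimizer_set g"
  then obtain y t where y: "y \<in> S" and t: "0 \<le> t" and pt: "p = (char_line g y t, t)"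
    and le: "ennreal t \<le> ts g y" by (auto simp: T_set_def)
  have n: "\<not> unique_minimizer g (char_line g y t, t) y"
    using p pt by (auto simp: unique_minimizer_set_def)
  then have "t \<noteq> 0" using minimizer_char_line_0 S y by metis
  then show "p \<in> singular_points S"
    unfolding pt using y t n le S le_ts_iff[of y t] by (intro singular_pointsI) auto
next
  fix p assume p: "p \<in> singular_points S"
  then have "p \<notin> unique_minimizer_set g" by (auto simp: singular_points_def)
  moreover obtain y t where "y \<in> S" "0 < t" "grad g y \<noteq> 0" "p = (char_line g y t, t)"
    "minimizer g (char_line g y t, t) y" "\<not> unique_minimizer g (char_line g y t, t) y"
    using p by (rule singular_pointsE)
  then have "p \<in> T_set g S" using le_ts_iff[of y t] ts_bar_le[of y t]
    unfolding T_set_def by (auto intro!: exI[of _ y] exI[of _ t])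
  ultimately show "p \<in> T_set g S - unique_minimizer_set g" by simp
qed

lemma M_set_iff:
  "y \<in> M_set g \<longleftrightarrow> grad g y \<noteq> 0 \<and> (\<exists>t>0. \<not> unique_minimizer g (char_line g y t, t) y)"
proof (cases "grad g y = 0")
  case False
  show ?thesis
  proof
    assume y: "y \<in> M_set g"
    then have "ts_bar g y < \<infinity>" by (simp add: M_set_def)
    then obtain c where c: "0 \<le> c" "ts_bar g y = ennreal c"
      by (cases "ts_bar g y" rule: ennreal_cases) auto
    have "\<not> unique_minimizer g (char_line g y (c + 1), c + 1) y"
    proof
      assume "unique_minimizer g (char_line g y (c + 1), c + 1) y"
      then have "ennreal (c + 1) \<le> ts_bar g y" unfolding ts_bar_def using c by (intro SUP_upper) auto
      then show False using c by simp
    qed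
    then show "grad g y \<noteq> 0 \<and> (\<exists>t>0. \<not> unique_minimizer g (char_line g y t, t) y)"
      using False c by (auto intro!: exI[of _ "c + 1"])
  next
    assume "grad g y \<noteq> 0 \<and> (\<exists>t>0. \<not> unique_minimizer g (char_line g y t, t) y)"
    then obtain t where "0 < t" "\<not> unique_minimizer g (char_line g y t, t) y" by blast
    then have "ts_bar g y \<le> ennreal t" by (rule ts_bar_le[OF False])
    also have "\<dots> < \<infinity>" by simp
    finally show "y \<in> M_set g" using False by (simp add: M_set_def)
  qed
qed (simp add: M_set_def)

lemma half_space_iff: "grad g y \<noteq> 0 \<Longrightarrow> z \<in> half_space g y \<longleftrightarrow> 0 < (z - y) \<bullet> nu y"
  by (simp add: half_space_def nu_def zero_less_mult_iff)

lemma open_E_set: "open (E_set g)"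
proof -
  have "E_set g = (\<Union>w. {y. grad g y \<noteq> 0} \<inter> {y. 0 < (w - y) \<bullet> grad g y} \<inter> {y. g w < g y})"
    by (auto simp: E_set_def half_space_def)
  moreover have "open \<dots>"
    by (intro open_UN ballI open_Int open_Collect_neq open_Collect_less continuous_intros
        continuous_grad continuous_g)
  ultimately show ?thesis by simp
qed

lemma path_comps_E_set:
  assumes "C \<in> path_comps (E_set g)"
  shows "open C" "C \<subseteq> E_set g" "C \<noteq> {}" "\<And>y z. y \<in> C \<Longrightarrow> z \<in> C \<Longrightarrow> path_component C y z"
proof -
  obtain x where x: "x \<in> E_set g" and C: "C = path_component_set (E_set g) x"
    using assms by (auto simp: path_comps_def)
  show "open C" unfolding C by (rule open_path_component[OF open_E_set])
  show "C \<subseteq> E_set g" unfolding C by (rule path_component_subset)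
  show "C \<noteq> {}" unfolding C path_component_eq_empty using x by simp
  show "\<And>y z. y \<in> C \<Longrightarrow> z \<in> C \<Longrightarrow> path_component C y z"
    using path_connected_path_component[of "E_set g" x] unfolding C
    by (simp add: path_connected_component)
qed

lemma countable_path_comps: "countable (path_comps (E_set g))"
proof (rule countable_disjoint_open_subsets)
  show "\<And>S. S \<in> path_comps (E_set g) \<Longrightarrow> open S" by (rule path_comps_E_set)
  show "disjoint (path_comps (E_set g))"
  proof (rule disjointI)
    fix A B assume "A \<in> path_comps (E_set g)" "B \<in> path_comps (E_set g)" "A \<noteq> B"
    then show "A \<inter> B = {}" unfolding path_comps_def using path_component_eq by blast
  qed
qed

text \<open>
The ball meets both \<open>{g > g y}\<close> and \<open>{g < g y}\<close>, since \<open>g\<close> increases in the direction \<open>nu y\<close>.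
\<close>

lemma level_nbhd_ball:
  assumes R: "0 < R" and nz: "\<And>z. z \<in> ball y R \<Longrightarrow> 0 < nu y \<bullet> grad g z"
  shows "level_nbhd g y (ball y R)"
proof -
  have nz': "\<And>z. z \<in> ball y R \<Longrightarrow> grad g z \<noteq> 0" using nz by force
  have nu1: "norm (nu y) = 1" using nz'[of y] R by (intro norm_nu) simp
  have gradc: "grad (\<lambda>z. g z - c) = grad g" for c
  proof
    fix z
    have "GDERIV (\<lambda>z. g z - c) z :> D \<longleftrightarrow> GDERIV g z :> D" for D
      using has_derivative_add[OF _ has_derivative_const, of "\<lambda>z. g z - c" _ "at z" c]
        has_derivative_diff[OF _ has_derivative_const, of g _ "at z" c]
      by (auto simp: gderiv_def)
    then show "grad (\<lambda>z. g z - c) z = grad g z" by (simp add: grad_def)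
  qed
  have "C1_hypersurface {z \<in> ball y R. g z = g y}"
    unfolding C1_hypersurface_def
  proof (intro ballI exI conjI)
    fix p assume p: "p \<in> {z \<in> ball y R. g z = g y}"
    show "open (ball y R)" "p \<in> ball y R" using p by auto
    show "C1_on (\<lambda>z. g z - g y) (ball y R)"
      unfolding C1_on_def gradc
      using continuous_grad has_derivative_diff[OF has_derivative_grad has_derivative_const]
      by (auto simp: differentiable_def)
    show "grad (\<lambda>z. g z - g y) z \<noteq> 0" if "z \<in> ball y R" for z using nz' that by (simp add: gradc)
    show "{z \<in> ball y R. g z = g y} \<inter> ball y R = {z \<in> ball y R. g z - g y = 0}" by auto
  qed
  moreover have "\<not> connected (ball y R - {z \<in> ball y R. g z = g y})"
  proof -
    have *: "g y < g (y + (R/2) *\<^sub>R nu y)" "g (y - (R/2) *\<^sub>R nu y) < g y"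
    proof -
      have d: "0 < g b - g a" if ab: "b - a = (R/2) *\<^sub>R nu y" "a \<in> ball y R" "b \<in> ball y R" for a b
      proof -
        obtain s where s: "0 < s" "s < 1" "g b - g a = (b - a) \<bullet> grad g (a + s *\<^sub>R (b - a))"
          by (rule mean_value)
        have "(1 - s) *\<^sub>R a + s *\<^sub>R b \<in> ball y R" using ab s by (intro convexD) auto
        then have "a + s *\<^sub>R (b - a) \<in> ball y R" by (simp add: algebra_simps)
        from nz[OF this] show ?thesis unfolding s(3) ab(1) using R by simp
      qed
      show "g y < g (y + (R/2) *\<^sub>R nu y)" "g (y - (R/2) *\<^sub>R nu y) < g y"
        using d[of "y + (R/2) *\<^sub>R nu y" y] d[of y "y - (R/2) *\<^sub>R nu y"] R nu1 by (auto simp: dist_norm)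
    qed
    have o: "open {z. g y < g z}" "open {z. g z < g y}"
      by (intro open_Collect_less continuous_intros continuous_g)+
    have i: "y + (R/2) *\<^sub>R nu y \<in> ball y R" "y - (R/2) *\<^sub>R nu y \<in> ball y R"
      using R nu1 by (auto simp: dist_norm)
    show ?thesis unfolding connected_def not_not
      by (rule exI[of _ "{z. g y < g z}"], rule exI[of _ "{z. g z < g y}"]) (use o i * in auto)
  qed
  ultimately show ?thesis using R by (simp add: level_nbhd_def)
qed

lemma not_E_set_ge:
  assumes "grad g y \<noteq> 0" "y \<notin> E_set g" "0 < (z - y) \<bullet> nu y"
  shows "g y \<le> g z"
  using assms half_space_iff[of y z] by (force simp: E_set_def)

text \<open>
The tangent balls at \<open>y\<close> exhaust the half space, so \<open>E\<close> is the set where the characteristic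
stops being minimizing after a finite time.
\<close>

lemma not_E_set_minimizer:
  assumes y: "grad g y \<noteq> 0" "y \<notin> E_set g" and t: "0 \<le> t"
  shows "minimizer g (char_line g y t, t) y"
  unfolding minimizer_char_line_iff[OF y(1) t]
proof (intro allI impI)
  fix z assume z: "(z - y) \<bullet> (z - y) \<le> 2 * t * ((z - y) \<bullet> nu y)"
  show "g y \<le> g z"
  proof (cases "z = y")
    case False
    then have "0 < (z - y) \<bullet> (z - y)" by simp
    then have "0 < 2 * t * ((z - y) \<bullet> nu y)" using z by linarith
    then have "0 < (z - y) \<bullet> nu y" using t by (simp add: zero_less_mult_iff)
    then show ?thesis by (rule not_E_set_ge[OF y])
  qed simp
qed

lemma other_minimizer:
  assumes y: "grad g y \<noteq> 0" and t: "0 < t" and m: "minimizer g (char_line g y t, t) y"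
    and n: "\<not> unique_minimizer g (char_line g y t, t) y"
  obtains w where "w \<noteq> y" "g w = g y" "(w - y) \<bullet> (w - y) \<le> 2 * t * ((w - y) \<bullet> nu y)"
    "0 < (w - y) \<bullet> nu y"
proof -
  obtain w where w: "w \<noteq> y" "minimizer g (char_line g y t, t) w"
    using n m by (auto simp: unique_minimizer_def)
  have le: "(w - y) \<bullet> (w - y) \<le> 2 * t * ((w - y) \<bullet> nu y)"
    using w cball_char_line[OF y, of t w] t by (simp add: minimizer_iff)
  moreover have "0 < (w - y) \<bullet> (w - y)" using w by simp
  ultimately have "0 < 2 * t * ((w - y) \<bullet> nu y)" by linarith
  then have "0 < (w - y) \<bullet> nu y" using t by (simp add: zero_less_mult_iff)
  moreover have "g w = g y" using w m hopf_lax_minimizer by metis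
  ultimately show ?thesis using that w le by blast
qed

lemma path_component_segment:
  fixes a b :: "real ^ 'n"
  assumes "closed_segment a b \<subseteq> S"
  shows "path_component S a b"
proof -
  have "path_component (closed_segment a b) a b"
    using convex_imp_path_connected[OF convex_closed_segment] unfolding path_connected_component
    by blast
  then show ?thesis by (rule path_component_of_subset[OF assms])
qed

text \<open>
Let \<open>w\<close> be another minimizer for a point of the characteristic of \<open>y\<close>. It lies in the half space of \<open>y\<close>
and \<open>g w = g y\<close>, so it shows that every \<open>z\<close> near \<open>y\<close> with \<open>g z > g y\<close> belongs to \<open>E\<close>. These \<open>z\<close> lie in one path
component: move two of them upwards along \<open>nu y\<close> by the same amount \<open>a\<close>; then the segment between
them stays above the level \<open>g y\<close>.
\<close>

lemma M_minus_E_in_F_set: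
  assumes y: "y \<in> M_set g - E_set g"
  shows "\<exists>C\<in>path_comps (E_set g). y \<in> F_set g C"
proof -
  have Dy: "grad g y \<noteq> 0" and "\<exists>t>0. \<not> unique_minimizer g (char_line g y t, t) y"
    using y by (auto simp: M_set_iff)
  then obtain t where t: "0 < t" "\<not> unique_minimizer g (char_line g y t, t) y" by blast
  obtain w where w: "w \<noteq> y" "g w = g y" "0 < (w - y) \<bullet> nu y"
    using other_minimizer[OF Dy t(1) not_E_set_minimizer t(2)] y Dy t by auto
  have w': "0 < (w - y) \<bullet> grad g y" using w half_space_iff[OF Dy] by (simp add: half_space_def)
  have nn: "nu y \<bullet> nu y = 1" using norm_nu[OF Dy] by (simp add: dot_square_norm)
  have "grad g y = norm (grad g y) *\<^sub>R nu y" using Dy by (simp add: nu_def)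
  then have ny: "0 < nu y \<bullet> grad g y" using nn Dy by (metis inner_scaleR_right mult.right_neutral zero_less_norm_iff)
  define V where "V = {z. 0 < nu y \<bullet> grad g z} \<inter> {z. 0 < (w - z) \<bullet> grad g z}"
  have "open V" unfolding V_def
    by (intro open_Int open_Collect_less continuous_intros continuous_grad)
  moreover have "y \<in> V" using ny w' by (simp add: V_def)
  ultimately obtain R where R: "0 < R" "ball y R \<subseteq> V" by (auto simp: open_contains_ball)
  have inE: "z \<in> E_set g" if "z \<in> ball y R" "g y < g z" for z
    using that R w by (force simp: E_set_def half_space_def V_def)
  have up: "g a \<le> g (a + c *\<^sub>R nu y)" if c: "0 \<le> c" "a \<in> ball y R" "a + c *\<^sub>R nu y \<in> ball y R" for a c
  proof -
    obtain s where s: "0 < s" "s < 1" "g (a + c *\<^sub>R nu y) - g a = (c *\<^sub>R nu y) \<bullet> grad g (a + s *\<^sub>R c *\<^sub>R nu y)"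
      using mean_value[of "a + c *\<^sub>R nu y" a] by auto
    have "(1 - s) *\<^sub>R a + s *\<^sub>R (a + c *\<^sub>R nu y) \<in> ball y R" using c s by (intro convexD) auto
    then have "a + s *\<^sub>R c *\<^sub>R nu y \<in> ball y R" by (simp add: algebra_simps)
    then have "0 < nu y \<bullet> grad g (a + s *\<^sub>R c *\<^sub>R nu y)" using R by (auto simp: V_def)
    then have "0 \<le> c * (nu y \<bullet> grad g (a + s *\<^sub>R c *\<^sub>R nu y))" using c by (intro mult_nonneg_nonneg) auto
    then show ?thesis using s(3) by simp
  qed
  have N: "level_nbhd g y (ball y R)" using R by (intro level_nbhd_ball) (auto simp: V_def)
  define a where "a = (R/2) *\<^sub>R nu y"
  have na: "norm a = R/2" using norm_nu[OF Dy] R by (simp add: a_def)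
  have "g y < g (y + a)"
  proof -
    obtain s where s: "0 < s" "s < 1" "g (y + a) - g y = a \<bullet> grad g (y + s *\<^sub>R a)"
      using mean_value[of "y + a" y] by auto
    have "y + s *\<^sub>R a \<in> ball y R" using s na R mult_left_le_one_le[of "norm a" s] by (simp add: dist_norm)
    then have "0 < nu y \<bullet> grad g (y + s *\<^sub>R a)" using R by (auto simp: V_def)
    then have "0 < a \<bullet> grad g (y + s *\<^sub>R a)" using R by (simp add: a_def)
    then show ?thesis using s(3) by simp
  qed
  then have "y \<in> {z. g y < g (z + a)}" by simp
  moreover have "open {z. g y < g (z + a)}"
    by (intro open_Collect_less continuous_intros continuous_on_compose2[OF continuous_g[of UNIV]]) auto
  ultimately obtain r0 where r0: "0 < r0" "\<And>z. z \<in> ball y r0 \<Longrightarrow> g y < g (z + a)"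
    unfolding open_contains_ball by blast
  define r where "r = min r0 (R/2)"
  have r: "0 < r" "r \<le> r0" "r \<le> R/2" using r0 R by (auto simp: r_def)
  have lift: "path_component (E_set g) z (z + a)" if z: "z \<in> ball y r" "g y < g z" for z
  proof -
    have "closed_segment z (z + a) \<subseteq> E_set g"
    proof
      fix v assume "v \<in> closed_segment z (z + a)"
      then obtain s where s: "0 \<le> s" "s \<le> 1" "v = z + s *\<^sub>R a"
        by (auto simp: in_segment algebra_simps)
      have "norm (s *\<^sub>R a) \<le> R/2" using s na R mult_left_le_one_le[of "norm a" s] by simp
      then have v: "v \<in> ball y R" using z r norm_triangle_ineq[of "z - y" "s *\<^sub>R a"]
        by (auto simp: dist_norm s norm_minus_commute algebra_simps)
      have "g z \<le> g (z + (s * (R/2)) *\<^sub>R nu y)"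
        using z r v s R by (intro up) (auto simp: a_def)
      then show "v \<in> E_set g" using z v by (intro inE) (auto simp: s a_def)
    qed
    then show ?thesis by (rule path_component_segment)
  qed
  have across: "path_component (E_set g) (z + a) (z' + a)" if z: "z \<in> ball y r" "z' \<in> ball y r" for z z'
  proof -
    have "closed_segment (z + a) (z' + a) \<subseteq> E_set g"
    proof
      fix v assume "v \<in> closed_segment (z + a) (z' + a)"
      then obtain s where s: "0 \<le> s" "s \<le> 1" "v = ((1 - s) *\<^sub>R z + s *\<^sub>R z') + a"
        by (auto simp: in_segment algebra_simps)
      have vr: "(1 - s) *\<^sub>R z + s *\<^sub>R z' \<in> ball y r" using z s by (intro convexD) auto
      then have "g y < g v" using r0 r s by auto
      moreover have "v \<in> ball y R"
        using vr r na norm_triangle_ineq[of "((1 - s) *\<^sub>R z + s *\<^sub>R z') - y" a]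
        by (auto simp: dist_norm s(3) norm_minus_commute algebra_simps)
      ultimately show "v \<in> E_set g" by (intro inE)
    qed
    then show ?thesis by (rule path_component_segment)
  qed
  define C where "C = path_component_set (E_set g) (y + a)"
  have "y + a \<in> E_set g" using path_component_mem[OF across[of y y]] r by simp
  then have "C \<in> path_comps (E_set g)" by (auto simp: C_def path_comps_def)
  moreover have "ball y r \<inter> H_plus g (ball y R) y \<subseteq> C"
  proof
    fix z assume "z \<in> ball y r \<inter> H_plus g (ball y R) y"
    then have z: "z \<in> ball y r" "g y < g z" by (auto simp: H_plus_def)
    have "path_component (E_set g) (y + a) (z + a)" using z r by (intro across) auto
    then show "z \<in> C" using path_component_trans path_component_sym[OF lift[OF z]]
      unfolding C_def by blast
  qed
  then have "\<exists>N U. level_nbhd g y N \<and> open U \<and> y \<in> U \<and> U \<inter> H_plus g N y \<subseteq> C"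
    using N r by (intro exI[of _ "ball y R"] exI[of _ "ball y r"]) simp
  then have "y \<in> F_set g C" using y by (simp add: F_set_def)
  ultimately show ?thesis by blast
qed

lemma F_set_grad: "C \<subseteq> E_set g \<Longrightarrow> y \<in> F_set g C \<Longrightarrow> grad g y \<noteq> 0"
  by (auto simp: F_set_def E_set_def M_set_def)

lemma singular_set_union:
  "singular_set g = (\<Union>C\<in>path_comps (E_set g). singular_points (F_set g C))"
proof (intro equalityI subsetI)
  fix p assume "p \<in> singular_set g"
  then obtain y t where y: "0 < t" "grad g y \<noteq> 0" "p = (char_line g y t, t)"
    "minimizer g (char_line g y t, t) y" "\<not> unique_minimizer g (char_line g y t, t) y"
    unfolding singular_set_eq by (rule singular_pointsE)
  have "\<exists>C\<in>path_comps (E_set g). y \<in> F_set g C"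
  proof (cases "y \<in> E_set g")
    case True
    then show ?thesis by (intro bexI[of _ "path_component_set (E_set g) y"])
        (auto simp: F_set_def path_comps_def path_component_refl)
  next
    case False
    then show ?thesis using y by (intro M_minus_E_in_F_set) (auto simp: M_set_iff)
  qed
  then show "p \<in> (\<Union>C\<in>path_comps (E_set g). singular_points (F_set g C))"
    using singular_pointsI y by blast
next
  fix p assume "p \<in> (\<Union>C\<in>path_comps (E_set g). singular_points (F_set g C))"
  then show "p \<in> singular_set g" unfolding singular_set_eq by (auto simp: singular_points_def)
qed

section \<open>The cut time\<close>

definition cut_time :: "real ^ 'n \<Rightarrow> real" where
  "cut_time y = Sup {t. 0 \<le> t \<and> minimizer g (char_line g y t, t) y}"

definition char_point :: "real ^ 'n \<Rightarrow> real \<Rightarrow> (real ^ 'n) \<times> real" where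
  "char_point y t = (char_line g y t, t)"

definition cut_point :: "real ^ 'n \<Rightarrow> (real ^ 'n) \<times> real" where
  "cut_point y = char_point y (cut_time y)"

lemma E_set_grad: "y \<in> E_set g \<Longrightarrow> grad g y \<noteq> 0"
  by (simp add: E_set_def)

lemma not_minimizer_eventually:
  assumes y: "y \<in> E_set g"
  obtains T where "0 \<le> T" "\<not> minimizer g (char_line g y T, T) y"
proof -
  obtain w where w: "w \<in> half_space g y" "g w < g y" using y by (auto simp: E_set_def)
  then have p: "0 < (w - y) \<bullet> nu y" using half_space_iff E_set_grad[OF y] by blast
  \<comment> \<open>the time at which the tangent ball reaches \<open>w\<close>\<close>
  define T where "T = ((w - y) \<bullet> (w - y)) / (2 * ((w - y) \<bullet> nu y))"
  have "0 \<le> T" using p by (simp add: T_def)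
  moreover have "(w - y) \<bullet> (w - y) \<le> 2 * T * ((w - y) \<bullet> nu y)" using p by (simp add: T_def)
  ultimately show ?thesis
    using that[of T] w minimizer_char_line_iff[OF E_set_grad[OF y], of T] by force
qed

lemma cut_time_iff:
  assumes y: "y \<in> E_set g" and t: "0 \<le> t"
  shows "minimizer g (char_line g y t, t) y \<longleftrightarrow> t \<le> cut_time y"
proof -
  note D = E_set_grad[OF y]
  let ?S = "{t. 0 \<le> t \<and> minimizer g (char_line g y t, t) y}"
  have 0: "0 \<in> ?S" using minimizer_char_line_0[OF D] by (simp add: unique_minimizer_def)
  obtain T where T: "0 \<le> T" "\<not> minimizer g (char_line g y T, T) y"
    by (rule not_minimizer_eventually[OF y])
  have "s \<le> T" if "s \<in> ?S" for s
  proof (rule ccontr)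
    assume "\<not> s \<le> T" then show False using minimizer_char_line_mono[OF D T(1), of s] T that by auto
  qed
  then have bdd: "bdd_above ?S" by (rule bdd_aboveI)
  show ?thesis
  proof
    assume "minimizer g (char_line g y t, t) y"
    then show "t \<le> cut_time y" unfolding cut_time_def using t bdd by (intro cSup_upper) auto
  next
    assume le: "t \<le> cut_time y"
    show "minimizer g (char_line g y t, t) y"
    proof (cases "t = 0")
      case False
      show ?thesis
      proof (rule minimizer_char_line_left_limit)
        fix s assume s: "0 < s" "s < t"
        then have "s < Sup ?S" using le by (simp add: cut_time_def)
        then obtain r where "r \<in> ?S" "s < r" using less_cSupD[of ?S s] 0 by blast
        then show "minimizer g (char_line g y s, s) y"
          using minimizer_char_line_mono[OF D, of s r] s by simp
      qed (use t False in simp)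
    qed (use 0 in simp)
  qed
qed

lemma cut_time_nonneg: "y \<in> E_set g \<Longrightarrow> 0 \<le> cut_time y"
  using cut_time_iff[of y 0] minimizer_char_line_0[OF E_set_grad] by (simp add: unique_minimizer_def)

lemma char_point_nu: "char_point y t = (y + t *\<^sub>R nu y, t)"
  by (simp add: char_point_def char_line_nu)

lemma tendsto_char_point:
  assumes "(y \<longlongrightarrow> y') F" "(t \<longlongrightarrow> t') F" "grad g y' \<noteq> 0"
  shows "((\<lambda>k. char_point (y k) (t k)) \<longlongrightarrow> char_point y' t') F"
  unfolding char_point_nu using assms by (intro tendsto_intros tendsto_nu)

lemma dist_char_point: "grad g y \<noteq> 0 \<Longrightarrow> dist (char_point y s) (char_point y t) \<le> 2 * \<bar>s - t\<bar>"
proof -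
  assume D: "grad g y \<noteq> 0"
  have "dist (char_point y s) (char_point y t) = norm ((s - t) *\<^sub>R nu y, s - t)"
    by (simp add: char_point_nu dist_norm scaleR_diff_left)
  also have "\<dots> \<le> norm ((s - t) *\<^sub>R nu y) + norm (s - t)" by (rule norm_Pair_le)
  also have "\<dots> = 2 * \<bar>s - t\<bar>" using norm_nu[OF D] by simp
  finally show ?thesis .
qed

lemma tangent_ball_nearby:
  assumes y: "grad g y \<noteq> 0" and s: "0 \<le> s" "s < T"
    and w: "w \<noteq> y" "(w - y) \<bullet> (w - y) \<le> 2 * s * ((w - y) \<bullet> nu y)"
  shows "\<forall>\<^sub>F z in nhds y. (w - z) \<bullet> (w - z) \<le> 2 * T * ((w - z) \<bullet> nu z)"
proof -
  have "((\<lambda>z. (w - z) \<bullet> (w - z) - 2 * T * ((w - z) \<bullet> nu z)) \<longlongrightarrow> (w - y) \<bullet> (w - y) - 2 * T * ((w - y) \<bullet> nu y)) (nhds y)"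
    by (intro tendsto_intros tendsto_nu filterlim_ident y)
  then have "\<forall>\<^sub>F z in nhds y. (w - z) \<bullet> (w - z) - 2 * T * ((w - z) \<bullet> nu z) < 0"
    using tangent_ball_strict_mono[OF s w(2,1)] by (intro order_tendstoD(2)) auto
  then show ?thesis by eventually_elim simp
qed

text \<open>
A point \<open>w\<close> with \<open>g w < g y\<close> in a tangent ball at \<open>y\<close> lies in the interior of the larger tangent balls,
hence also in those of nearby points.
\<close>

lemma cut_time_upper_semicontinuous:
  assumes y: "y \<in> E_set g" and T: "cut_time y < T"
  shows "\<forall>\<^sub>F z in nhds y. cut_time z \<le> T"
proof -
  define s where "s = (cut_time y + T) / 2"
  have s: "0 \<le> s" "s < T" "cut_time y < s" using T cut_time_nonneg[OF y] by (auto simp: s_def)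
  then have "\<not> minimizer g (char_line g y s, s) y" using cut_time_iff[OF y] by simp
  then obtain w where w: "(w - y) \<bullet> (w - y) \<le> 2 * s * ((w - y) \<bullet> nu y)" "g w < g y"
    using minimizer_char_line_iff[OF E_set_grad[OF y] s(1)] by (meson not_le)
  then have "w \<noteq> y" by auto
  from tangent_ball_nearby[OF E_set_grad[OF y] s(1,2) this w(1)]
  have 1: "\<forall>\<^sub>F z in nhds y. (w - z) \<bullet> (w - z) \<le> 2 * T * ((w - z) \<bullet> nu z)" .
  have 2: "\<forall>\<^sub>F z in nhds y. g w < g z"
    by (rule order_tendstoD(1)[OF tendsto_g[OF filterlim_ident] w(2)])
  have 3: "\<forall>\<^sub>F z in nhds y. z \<in> E_set g" using open_E_set y by (rule eventually_nhds_in_open)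
  from 1 2 3 show ?thesis
  proof eventually_elim
    case (elim z)
    then have "\<not> minimizer g (char_line g z T, T) z"
      using minimizer_char_line_iff[OF E_set_grad[of z], of T] s by force
    then show ?case using cut_time_iff[of z T] elim s by simp
  qed
qed

section \<open>Propagation of singularities along characteristics\<close>

lemma continuous_on_minimizer:
  assumes "\<And>q. q \<in> N \<Longrightarrow> unique_minimizer g q (Y q)"
  shows "continuous_on N Y"
  unfolding continuous_on_iff
proof (intro ballI allI impI)
  fix q and e :: real assume q: "q \<in> N" "0 < e"
  obtain \<rho> where "0 < \<rho>" "\<And>q' z. dist q' q < \<rho> \<Longrightarrow> minimizer g q' z \<Longrightarrow> z \<in> ball (Y q) e"
    using minimizers_nearby[of "ball (Y q) e" q] assms[OF q(1)] q(2) by (auto simp: unique_minimizer_def)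
  moreover have "minimizer g q' (Y q')" if "q' \<in> N" for q'
    using assms[OF that] by (simp add: unique_minimizer_def)
  ultimately show "\<exists>d>0. \<forall>q'\<in>N. dist q' q < d \<longrightarrow> dist (Y q') (Y q) < e"
    by (metis dist_commute mem_ball)
qed

text \<open>
If minimizers at time \<open>t + \<eta>\<close> near \<open>x + \<eta> *\<^sub>R v\<close> are unique and their directions are close to \<open>v\<close>,
one of their characteristics passes through \<open>x\<close> at time \<open>t\<close>. This is Brouwer's fixed point theorem for the map
that sends \<open>x'\<close> to \<open>x\<close> moved by \<open>\<eta>\<close> in the direction of the minimizer of \<open>x'\<close>.
\<close>

lemma characteristic_through_point:
  assumes t: "0 \<le> t" and \<eta>: "0 < \<eta>"
    and u: "\<And>x'. x' \<in> cball (x + \<eta> *\<^sub>R v) \<eta> \<Longrightarrow>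
      \<exists>y. unique_minimizer g (x', t + \<eta>) y \<and> grad g y \<noteq> 0 \<and> norm (nu y - v) \<le> 1"
  obtains y where "grad g y \<noteq> 0" "minimizer g (x, t) y"
    "minimizer g (char_line g y (t + \<eta>), t + \<eta>) y"
proof -
  let ?D = "cball (x + \<eta> *\<^sub>R v) \<eta>"
  obtain Y where Y: "\<And>x'. x' \<in> ?D \<Longrightarrow> unique_minimizer g (x', t + \<eta>) (Y x')"
    "\<And>x'. x' \<in> ?D \<Longrightarrow> grad g (Y x') \<noteq> 0" "\<And>x'. x' \<in> ?D \<Longrightarrow> norm (nu (Y x') - v) \<le> 1"
    using u by metis
  have "continuous_on (?D \<times> {t + \<eta>}) (\<lambda>q. Y (fst q))"
    by (rule continuous_on_minimizer) (use Y in auto)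
  moreover have "continuous_on ?D (\<lambda>x'. (x', t + \<eta>))" by (intro continuous_intros)
  ultimately have "continuous_on ?D (\<lambda>x'. Y (fst (x', t + \<eta>)))"
    by (rule continuous_on_compose2) auto
  then have cY: "continuous_on ?D Y" by simp
  have cn: "continuous_on ?D (\<lambda>x'. nu (Y x'))"
    by (rule continuous_on_compose2[OF continuous_nu cY, of "Y ` ?D"]) (use Y(2) in blast)+
  obtain x' where x': "x' \<in> ?D" "x + \<eta> *\<^sub>R nu (Y x') = x'"
  proof (rule brouwer[of ?D "\<lambda>x'. x + \<eta> *\<^sub>R nu (Y x')"])
    show "continuous_on ?D (\<lambda>x'. x + \<eta> *\<^sub>R nu (Y x'))" by (intro continuous_intros cn)
    show "(\<lambda>x'. x + \<eta> *\<^sub>R nu (Y x')) \<in> ?D \<rightarrow> ?D"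
    proof
      fix x' assume "x' \<in> ?D"
      then have "norm (nu (Y x') - v) \<le> 1" by (rule Y)
      then have "norm (\<eta> *\<^sub>R (nu (Y x') - v)) \<le> \<eta>" using \<eta> by (simp add: mult_left_le)
      then show "x + \<eta> *\<^sub>R nu (Y x') \<in> ?D" by (simp add: dist_norm norm_minus_commute algebra_simps)
    qed
  qed (use \<eta> in auto)
  define y where "y = Y x'"
  have y: "grad g y \<noteq> 0" "minimizer g (x', t + \<eta>) y" using Y x' by (auto simp: y_def unique_minimizer_def)
  then have c: "x' = char_line g y (t + \<eta>)" by (intro minimizer_on_char_line)
  have "x = x' - \<eta> *\<^sub>R nu y" using x'(2) by (simp add: y_def eq_diff_eq)
  also have "\<dots> = char_line g y t" unfolding c by (simp add: char_line_nu algebra_simps)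
  finally have "x = char_line g y t" .
  then have "minimizer g (x, t) y" using minimizer_char_line_mono[OF y(1) t, of "t + \<eta>"] y c \<eta> by simp
  then show ?thesis using that y c by simp
qed

text \<open>
Otherwise the cut point has the unique minimizer \<open>y\<close>, and so have all points near it a unique
minimizer near \<open>y\<close>. One of these minimizes beyond the cut time along a characteristic through the cut
point; it minimizes at the cut point too, hence is \<open>y\<close>, against the definition of the cut time.
\<close>

lemma cut_point_in_closure:
  assumes C: "open C" "C \<subseteq> E_set g" and y: "y \<in> C" and pos: "0 < cut_time y"
  shows "cut_point y \<in> closure (singular_points C)"
proof (rule ccontr)
  assume n: "cut_point y \<notin> closure (singular_points C)"
  have yE: "y \<in> E_set g" and D: "grad g y \<noteq> 0" using C y E_set_grad by auto
  let ?t = "cut_time y"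
  have m: "minimizer g (char_line g y ?t, ?t) y" using cut_time_iff[OF yE, of ?t] pos by simp
  have "cut_point y \<notin> singular_points C" using n closure_subset by blast
  then have u: "unique_minimizer g (char_line g y ?t, ?t) y"
    using singular_pointsI[OF y pos D m] by (auto simp: cut_point_def char_point_def)
  obtain e where e: "0 < e" "\<And>q. dist q (cut_point y) < e \<Longrightarrow> q \<notin> singular_points C"
    using n unfolding closure_approachable by (meson not_less)
  have "((\<lambda>z. norm (nu z - nu y)) \<longlongrightarrow> norm (nu y - nu y)) (nhds y)"
    by (intro tendsto_intros tendsto_nu filterlim_ident D)
  then have "\<forall>\<^sub>F z in nhds y. norm (nu z - nu y) < 1" by (rule order_tendstoD(2)) simp
  moreover have "\<forall>\<^sub>F z in nhds y. z \<in> C" using C(1) y by (rule eventually_nhds_in_open)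
  ultimately have "\<forall>\<^sub>F z in nhds y. norm (nu z - nu y) < 1 \<and> z \<in> C" by eventually_elim simp
  then obtain V where V: "open V" "y \<in> V" "\<And>z. z \<in> V \<Longrightarrow> norm (nu z - nu y) < 1 \<and> z \<in> C"
    unfolding eventually_nhds by blast
  obtain \<rho> where \<rho>: "0 < \<rho>" "\<And>q z. dist q (cut_point y) < \<rho> \<Longrightarrow> minimizer g q z \<Longrightarrow> z \<in> V"
    using minimizers_nearby[of V "cut_point y"] V u
    by (metis char_point_def cut_point_def unique_minimizer_def)
  \<comment> \<open>points at time \<open>\<eta>\<close> after the cut point, up to \<open>\<eta>\<close> off the characteristic, are within \<open>3 \<eta>\<close> of the cut point\<close>
  define \<eta> where "\<eta> = min e \<rho> / 4"
  have \<eta>: "0 < \<eta>" "3 * \<eta> < e" "3 * \<eta> < \<rho>" using e \<rho> by (auto simp: \<eta>_def)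
  have "\<exists>z. unique_minimizer g (x', ?t + \<eta>) z \<and> grad g z \<noteq> 0 \<and> norm (nu z - nu y) \<le> 1"
    if x': "x' \<in> cball (char_line g y ?t + \<eta> *\<^sub>R nu y) \<eta>" for x'
  proof -
    have "dist x' (char_line g y ?t) \<le> dist x' (char_line g y ?t + \<eta> *\<^sub>R nu y) + norm (\<eta> *\<^sub>R nu y)"
      using dist_triangle[of x' "char_line g y ?t" "char_line g y ?t + \<eta> *\<^sub>R nu y"] by (simp add: dist_norm)
    also have "\<dots> \<le> 2 * \<eta>" using x' \<eta> norm_nu[OF D] by (simp add: dist_commute)
    finally have "dist (x', ?t + \<eta>) (cut_point y) \<le> 3 * \<eta>"
      using norm_Pair_le[of "x' - char_line g y ?t" \<eta>] \<eta>
      by (simp add: cut_point_def char_point_def dist_norm)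
    then have near: "dist (x', ?t + \<eta>) (cut_point y) < e" "dist (x', ?t + \<eta>) (cut_point y) < \<rho>"
      using \<eta> by auto
    obtain z where z: "minimizer g (x', ?t + \<eta>) z" using exists_minimizer pos \<eta> by (meson add_nonneg_nonneg less_imp_le)
    then have zV: "z \<in> V" using \<rho> near by blast
    then have zC: "z \<in> C" "grad g z \<noteq> 0" using V C E_set_grad by auto
    have "(x', ?t + \<eta>) \<in> unique_minimizer_set g"
      using e(2)[OF near(1)] z zC pos \<eta> by (auto simp: singular_points_def)
    then have "unique_minimizer g (x', ?t + \<eta>) z" using z by (auto simp: unique_minimizer_set_def unique_minimizer_def)
    then show ?thesis using zC V(3)[OF zV] by auto
  qed
  then obtain z where z: "minimizer g (char_line g y ?t, ?t) z" "minimizer g (char_line g z (?t + \<eta>), ?t + \<eta>) z"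
    using characteristic_through_point[of ?t \<eta> "char_line g y ?t" "nu y"] pos \<eta> by (metis less_imp_le)
  then have "z = y" using u by (simp add: unique_minimizer_def)
  then show False using z(2) cut_time_iff[OF yE, of "?t + \<eta>"] pos \<eta> by simp
qed

text \<open>
Suppose the later point has a neighbourhood \<open>N\<close> without singular points. The map that moves each point of
\<open>N\<close> back by the time \<open>r - s\<close> along its characteristic takes values with a unique minimizer, the same as before,
and therefore is injective. By invariance of domain its image is a neighbourhood of the earlier point.
\<close>

lemma singular_closure_propagates:
  assumes C: "open C" "C \<subseteq> E_set g" and y: "y \<in> C"
    and s: "0 < s" "s < r" "r \<le> cut_time y"
    and cl: "char_point y s \<in> closure (singular_points UNIV)"
  shows "char_point y r \<in> closure (singular_points C)"
proof (rule ccontr)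
  assume n: "char_point y r \<notin> closure (singular_points C)"
  have yE: "y \<in> E_set g" and D: "grad g y \<noteq> 0" using C y E_set_grad by auto
  have m: "minimizer g (char_line g y r, r) y" using cut_time_iff[OF yE, of r] s by simp
  have "char_point y r \<notin> singular_points C" using n closure_subset by blast
  then have u: "unique_minimizer g (char_point y r) y"
    using singular_pointsI[OF y _ D m] s by (auto simp: char_point_def)
  obtain \<rho> where \<rho>: "0 < \<rho>" "\<And>q z. dist q (char_point y r) < \<rho> \<Longrightarrow> minimizer g q z \<Longrightarrow> z \<in> C"
    using minimizers_nearby[of C "char_point y r"] C y u by (metis unique_minimizer_def)
  define \<eta> where "\<eta> = r - s"
  define N where "N = ball (char_point y r) \<rho> \<inter> - closure (singular_points C) \<inter> {q. \<eta> < snd q}"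
  have N: "open N" unfolding N_def
    by (intro open_Int open_ball open_Collect_less continuous_intros) auto
  have pN: "char_point y r \<in> N" using n \<rho> s by (simp add: N_def \<eta>_def char_point_def)
  have "\<exists>z. unique_minimizer g q z \<and> z \<in> C" if q: "q \<in> N" for q
  proof -
    have q0: "0 < snd q" using q s by (auto simp: N_def \<eta>_def)
    then obtain z where z: "minimizer g q z" using exists_minimizer[of "snd q" "fst q"] by auto
    have "dist q (char_point y r) < \<rho>" using q by (simp add: N_def dist_commute)
    then have zC: "z \<in> C" by (rule \<rho>(2)[OF _ z])
    have "q \<notin> singular_points C" using q closure_subset by (auto simp: N_def)
    then have "q \<in> unique_minimizer_set g"
      using z zC q0 C E_set_grad by (cases q) (auto simp: singular_points_def)
    then show ?thesis using z zC by (auto simp: unique_minimizer_set_def unique_minimizer_def)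
  qed
  then obtain Y where Y: "\<And>q. q \<in> N \<Longrightarrow> unique_minimizer g q (Y q)" "\<And>q. q \<in> N \<Longrightarrow> Y q \<in> C"
    by metis
  have DY: "grad g (Y q) \<noteq> 0" if "q \<in> N" for q using Y(2)[OF that] C E_set_grad by auto
  have q_eq: "q = char_point (Y q) (snd q)" if "q \<in> N" for q
    using minimizer_on_char_line[of "fst q" "snd q" "Y q"] Y(1)[OF that] DY[OF that]
    by (cases q) (simp add: char_point_def unique_minimizer_def)
  define \<Psi> where "\<Psi> q = char_point (Y q) (snd q - \<eta>)" for q
  have u\<Psi>: "unique_minimizer g (\<Psi> q) (Y q)" if q: "q \<in> N" for q
    using unique_minimizer_char_line_mono[OF DY[OF q], of "snd q - \<eta>" "snd q"] Y(1)[OF q] q_eq[OF q] q s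
    by (auto simp: \<Psi>_def char_point_def N_def \<eta>_def)
  have "inj_on \<Psi> N"
  proof (rule inj_onI)
    fix q q' assume q: "q \<in> N" "q' \<in> N" "\<Psi> q = \<Psi> q'"
    then have "Y q = Y q'" using u\<Psi> by (metis unique_minimizer_def)
    moreover have "snd q = snd q'" using q by (simp add: \<Psi>_def char_point_def)
    ultimately show "q = q'" using q_eq q by metis
  qed
  moreover have "continuous_on N \<Psi>"
  proof -
    have cY: "continuous_on N Y" by (rule continuous_on_minimizer[OF Y(1)])
    have "continuous_on N (\<lambda>q. nu (Y q))"
      by (rule continuous_on_compose2[OF continuous_nu cY, of "Y ` N"]) (use DY in auto)
    then show ?thesis unfolding \<Psi>_def char_point_nu by (intro continuous_intros cY)
  qed
  ultimately have "open (\<Psi> ` N)" using N by (intro invariance_of_domain)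
  moreover have "char_point y s \<in> \<Psi> ` N"
  proof (rule image_eqI[OF _ pN])
    have "Y (char_point y r) = y" using Y(1)[OF pN] u by (simp add: unique_minimizer_def)
    then show "char_point y s = \<Psi> (char_point y r)" by (simp add: \<Psi>_def \<eta>_def char_point_def)
  qed
  ultimately obtain q where "q \<in> N" "\<Psi> q \<in> singular_points UNIV"
    using cl open_Int_closure_eq_empty[of "\<Psi> ` N" "singular_points UNIV"] by blast
  then show False using u\<Psi>[of q] by (auto simp: singular_points_def unique_minimizer_set_def)
qed

section \<open>Almost connectedness over a path component of E\<close>

text \<open>
In the application \<open>C\<close> is a path component of \<open>E\<close> and \<open>G\<close> is \<open>T(F\<^sub>C)\<close> without the points that have a unique
minimizer.
\<close>

context
  fixes C :: "(real ^ 'n) set" and G :: "((real ^ 'n) \<times> real) set" and \<delta> :: real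
  assumes C: "open C" "C \<subseteq> E_set g"
    and G: "singular_points C \<subseteq> G" "G \<subseteq> singular_points UNIV"
    and \<delta>: "0 < \<delta>"
begin

text \<open>
Consider the last time at which the characteristic is in the closure of \<open>B\<close>. If it precedes the cut
time, the characteristic is a little later still in the closure of \<open>G\<close>, at a distance less than \<open>\<delta>\<close>
from the closure of \<open>B\<close>, so in the closure of \<open>B\<close> by saturation.
\<close>

lemma cut_point_colour:
  assumes B: "saturated \<delta> G B" and y: "y \<in> C" and s: "0 < s" "s \<le> cut_time y"
    and cl: "char_point y s \<in> closure B"
  shows "cut_point y \<in> closure B"
proof (rule ccontr)
  assume n: "cut_point y \<notin> closure B"
  have D: "grad g y \<noteq> 0" using C y E_set_grad by auto
  define S where "S = {r. char_point y r \<in> closure B} \<inter> {s..cut_time y}"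
  have "continuous_on UNIV (char_point y)" unfolding char_point_nu[abs_def] by (intro continuous_intros)
  then have "closed {r. char_point y r \<in> closure B}"
    using continuous_closed_vimage[of "closure B" "char_point y"]
    by (simp add: vimage_def continuous_on_eq_continuous_at)
  then have "closed S" unfolding S_def by (intro closed_Int closed_atLeastAtMost)
  moreover have sS: "s \<in> S" using s cl by (simp add: S_def)
  moreover have bdd: "bdd_above S" unfolding S_def by (intro bdd_above_Int2 bdd_above_Icc)
  ultimately have "Sup S \<in> S" by (intro closed_contains_Sup) auto
  then have \<sigma>: "char_point y (Sup S) \<in> closure B" "s \<le> Sup S" "Sup S \<le> cut_time y" by (auto simp: S_def)
  have "Sup S \<noteq> cut_time y" using n \<sigma> by (auto simp: cut_point_def)
  \<comment> \<open>points of a characteristic have at most twice the distance of their times\<close>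
  define r where "r = min (cut_time y) (Sup S + \<delta> / 4)"
  have r: "Sup S < r" "r \<le> cut_time y" "r \<le> Sup S + \<delta> / 4"
    using \<sigma> \<open>Sup S \<noteq> cut_time y\<close> \<delta> by (auto simp: r_def)
  have "B \<subseteq> singular_points UNIV" using B G by (auto simp: saturated_def)
  then have "char_point y r \<in> closure (singular_points C)"
    using \<sigma> s r closure_mono by (intro singular_closure_propagates[OF C y, of "Sup S"]) auto
  then have rG: "char_point y r \<in> closure G" using closure_mono[OF G(1)] by blast
  have "dist (char_point y (Sup S)) (char_point y r) < \<delta>"
    using dist_char_point[OF D, of "Sup S" r] r \<delta> by simp
  then have "r \<in> S" using saturated_closure[OF B \<sigma>(1) rG] r \<sigma> by (simp add: S_def)
  then show False using cSup_upper[OF _ bdd, of r] r by simp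
qed

text \<open>
The colour of a space-time point is the part of \<open>G\<close> to whose closure the cut point of its minimizer belongs.
For several minimizers the choice does not matter, by \<open>coloured_disjoint\<close>.
\<close>

definition coloured :: "((real ^ 'n) \<times> real) set \<Rightarrow> ((real ^ 'n) \<times> real) set" where
  "coloured B = {q. 0 < snd q \<and> (\<exists>y\<in>C. minimizer g q y \<and> cut_point y \<in> closure B)}"

lemma minimizer_in_C:
  assumes "y \<in> C" "minimizer g q y" "0 < snd q"
  shows "q = char_point y (snd q)" "snd q \<le> cut_time y"
proof -
  have "fst q = char_line g y (snd q)"
    using assms C E_set_grad by (intro minimizer_on_char_line) auto
  then show "q = char_point y (snd q)" by (simp add: char_point_def prod_eq_iff)
  then show "snd q \<le> cut_time y" using assms C cut_time_iff[of y "snd q"]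
    by (auto simp: char_point_def)
qed

text \<open>
The cut times of the minimizers \<open>y\<^sub>k\<close> along the sequence accumulate at some \<open>\<tau>\<close> between the time of
\<open>p\<close> and the cut time of the limit minimizer \<open>y\<close>. So the closure of \<open>B\<close> contains a point of
the characteristic of \<open>y\<close>, and then the cut point of \<open>y\<close>. The cut times need not converge to that of \<open>y\<close>,
which is why \<open>cut_point_colour\<close> is needed.
\<close>

lemma coloured_limit:
  assumes B: "saturated \<delta> G B" and q: "\<And>k. q k \<in> coloured B" and lim: "q \<longlonglongrightarrow> p"
    and p: "0 < snd p" "\<And>y. minimizer g p y \<Longrightarrow> y \<in> C"
  shows "p \<in> coloured B"
proof -
  obtain Y where Y: "\<And>k. Y k \<in> C" "\<And>k. minimizer g (q k) (Y k)" "\<And>k. cut_point (Y k) \<in> closure B"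
    using q unfolding coloured_def mem_Collect_eq by metis
  obtain r y where r: "strict_mono r" and Yr: "(Y \<circ> r) \<longlonglongrightarrow> y" and my: "minimizer g p y"
    by (rule minimizer_subsequence[OF Y(2) lim])
  have y: "y \<in> C" using p my by blast
  then have yE: "y \<in> E_set g" "grad g y \<noteq> 0" using C E_set_grad by auto
  \<comment> \<open>truncation makes the cut times bounded; by upper semicontinuity it has no effect in the limit\<close>
  define c where "c k = min (cut_time (Y (r k))) (cut_time y + 1)" for k
  have "c k \<in> {0..cut_time y + 1}" for k
    using cut_time_nonneg[of "Y (r k)"] cut_time_nonneg[of y] Y C yE by (auto simp: c_def)
  then obtain \<tau> l where l: "strict_mono l" and cl: "(c \<circ> l) \<longlonglongrightarrow> \<tau>"
    using compact_Icc[of 0 "cut_time y + 1"] unfolding compact_def by metis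
  define m where "m = (\<lambda>k. r (l k))"
  have "strict_mono m" using r l by (simp add: m_def strict_mono_def)
  have Ym: "(\<lambda>k. Y (m k)) \<longlonglongrightarrow> y" using LIMSEQ_subseq_LIMSEQ[OF Yr l] by (simp add: m_def o_def)
  have up: "\<forall>\<^sub>F k in sequentially. cut_time (Y (m k)) \<le> cut_time y + e" if "0 < e" for e
    by (rule eventually_compose_filterlim[OF cut_time_upper_semicontinuous[OF yE(1)] Ym]) (use that in simp)
  have eq: "\<forall>\<^sub>F k in sequentially. c (l k) = cut_time (Y (m k))"
    using up[OF zero_less_one] by eventually_elim (simp add: c_def m_def)
  have cl: "(\<lambda>k. c (l k)) \<longlonglongrightarrow> \<tau>" using cl by (simp add: o_def)
  then have ct: "(\<lambda>k. cut_time (Y (m k))) \<longlonglongrightarrow> \<tau>" using eq by (rule Lim_transform_eventually)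
  have "\<tau> \<le> cut_time y"
  proof (rule field_le_epsilon)
    fix e :: real assume "0 < e"
    then show "\<tau> \<le> cut_time y + e" using tendsto_upperbound[OF ct up] by simp
  qed
  moreover have "snd p \<le> \<tau>"
  proof (rule tendsto_le[OF _ ct])
    show "(\<lambda>k. snd (q (m k))) \<longlonglongrightarrow> snd p"
      using LIMSEQ_subseq_LIMSEQ[OF tendsto_snd[OF lim] \<open>strict_mono m\<close>] by (simp add: o_def)
    show "\<forall>\<^sub>F k in sequentially. snd (q (m k)) \<le> cut_time (Y (m k))"
      using minimizer_in_C(2) Y q by (auto simp: coloured_def)
  qed simp
  moreover have "char_point y \<tau> \<in> closure B"
  proof (rule Lim_in_closed_set)
    show "(\<lambda>k. char_point (Y (m k)) (cut_time (Y (m k)))) \<longlonglongrightarrow> char_point y \<tau>"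
      by (rule tendsto_char_point[OF Ym ct yE(2)])
    show "\<forall>\<^sub>F k in sequentially. char_point (Y (m k)) (cut_time (Y (m k))) \<in> closure B"
      using Y(3) by (simp add: cut_point_def)
  qed auto
  ultimately have "cut_point y \<in> closure B" using p by (intro cut_point_colour[OF B y, of \<tau>]) auto
  then show ?thesis using y my p by (auto simp: coloured_def)
qed

lemma cut_point_coloured:
  assumes B: "saturated \<delta> G B" and y: "y \<in> C" "0 < cut_time y"
  shows "cut_point y \<in> closure B \<or> cut_point y \<in> closure (G - B)"
proof -
  have "cut_point y \<in> closure (singular_points C)" by (rule cut_point_in_closure[OF C y])
  also have "\<dots> \<subseteq> closure (B \<union> (G - B))" using G by (intro closure_mono) auto
  also have "\<dots> = closure B \<union> closure (G - B)" by (rule closure_Un)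
  finally show ?thesis by blast
qed

text \<open>
A point with both colours has two minimizers in \<open>C\<close>, so it belongs to \<open>G\<close> itself; its own part then
determines the colour of each of its minimizers.
\<close>

lemma coloured_disjoint:
  assumes B: "saturated \<delta> G B"
  shows "coloured B \<inter> coloured (G - B) = {}"
proof (rule ccontr)
  assume "\<not> ?thesis"
  then obtain q y y' where q: "0 < snd q" and y: "y \<in> C" "minimizer g q y" "cut_point y \<in> closure B"
    and y': "y' \<in> C" "minimizer g q y'" "cut_point y' \<in> closure (G - B)"
    unfolding coloured_def by blast
  note B' = saturated_Diff[OF B]
  have "y \<noteq> y'" using saturated_disjoint_closure[OF \<delta> B] y y' by blast
  then have "q \<in> singular_points C" using y y' q C E_set_grad
    by (cases q) (auto simp: singular_points_def unique_minimizer_set_def unique_minimizer_def)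
  then have "q \<in> closure B \<or> q \<in> closure (G - B)" using G(1) closure_subset[of B] closure_subset[of "G - B"] by blast
  then show False
  proof
    assume "q \<in> closure B"
    then have "cut_point y' \<in> closure B"
      using minimizer_in_C[OF y'(1,2) q] q by (intro cut_point_colour[OF B y'(1), of "snd q"]) auto
    then show False using y' saturated_disjoint_closure[OF \<delta> B] by blast
  next
    assume "q \<in> closure (G - B)"
    then have "cut_point y \<in> closure (G - B)"
      using minimizer_in_C[OF y(1,2) q] q by (intro cut_point_colour[OF B' y(1), of "snd q"]) auto
    then show False using y saturated_disjoint_closure[OF \<delta> B] by blast
  qed
qed

text \<open>
On the connected set \<open>K\<close> of points at the small time \<open>t\<close> over a neighbourhood of a path in \<open>C\<close>, all minimizers
lie in \<open>C\<close>. So the points of \<open>K\<close> of either colour form two disjoint closed sets that cover \<open>K\<close>.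
\<close>

lemma colour_constant:
  assumes B: "saturated \<delta> G B" and path: "path_component C y1 y2"
    and pos: "0 < cut_time y1" "0 < cut_time y2" and y1: "cut_point y1 \<in> closure B"
  shows "cut_point y2 \<in> closure B"
proof (rule ccontr)
  assume n: "cut_point y2 \<notin> closure B"
  obtain \<gamma> where \<gamma>: "path \<gamma>" "path_image \<gamma> \<subseteq> C" "pathstart \<gamma> = y1" "pathfinish \<gamma> = y2"
    using path unfolding path_component_def by blast
  have yC: "y1 \<in> C" "y2 \<in> C" using path path_component_mem by auto
  obtain r where r: "0 < r" "(\<Union>x\<in>path_image \<gamma>. cball x r) \<subseteq> C"
    using compact_subset_open_imp_cball_epsilon_subset[OF compact_path_image[OF \<gamma>(1)] C(1) \<gamma>(2)] by blast
  define t where "t = min (r / 2) (min (cut_time y1) (cut_time y2))"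
  have t: "0 < t" "2 * t \<le> r" "t \<le> cut_time y1" "t \<le> cut_time y2" using r pos by (auto simp: t_def)
  define K where "K = (\<lambda>p. (fst p + snd p, t)) ` (path_image \<gamma> \<times> cball 0 t)"
  have "compact K" "connected K" unfolding K_def
    by (intro compact_continuous_image connected_continuous_image continuous_intros compact_Times
        connected_Times compact_path_image connected_path_image \<gamma> compact_cball connected_cball)+
  have Ksnd: "snd p = t" if "p \<in> K" for p using that by (auto simp: K_def)
  have KC: "y \<in> C" if "p \<in> K" "minimizer g p y" for p y
  proof -
    obtain u where "u \<in> path_image \<gamma> \<times> cball 0 t" "p = (fst u + snd u, t)"
      using \<open>p \<in> K\<close> unfolding K_def by blast
    then obtain x w where xw: "x \<in> path_image \<gamma>" "norm w \<le> t" "p = (x + w, t)" by (cases u) auto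
    have "norm (y - (x + w)) \<le> t" using that xw by (simp add: minimizer_iff)
    then have "norm (y - x) \<le> 2 * t" using xw norm_triangle_ineq[of "y - (x + w)" w] by simp
    then have "y \<in> cball x r" using t by (simp add: dist_norm norm_minus_commute)
    then show ?thesis using r xw by blast
  qed
  have closedK: "closed (K \<inter> coloured B')" if B': "saturated \<delta> G B'" for B'
    unfolding closed_sequential_limits
  proof (intro allI impI, elim conjE)
    fix q p assume q: "\<forall>k. q k \<in> K \<inter> coloured B'" and lim: "q \<longlonglongrightarrow> p"
    have pK: "p \<in> K" using q lim compact_imp_closed[OF \<open>compact K\<close>] closed_sequentially[of K q p] by blast
    have "p \<in> coloured B'"
      by (rule coloured_limit[OF B' _ lim]) (use q Ksnd[OF pK] t KC[OF pK] in auto)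
    then show "p \<in> K \<inter> coloured B'" using pK by simp
  qed
  have inK: "char_point y t \<in> K" if "y \<in> path_image \<gamma>" "y \<in> C" for y
    unfolding K_def char_point_nu
    by (rule image_eqI[of _ _ "(y, t *\<^sub>R nu y)"]) (use that norm_nu[of y] E_set_grad C t in auto)
  have inB: "char_point y t \<in> coloured B'" if "y \<in> C" "t \<le> cut_time y" "cut_point y \<in> closure B'" for y B'
    using that t C cut_time_iff[of y t] by (auto simp: coloured_def char_point_def)
  have "cut_point y2 \<in> closure (G - B)" using cut_point_coloured[OF B yC(2) pos(2)] n by blast
  then have 2: "(K \<inter> coloured (G - B)) \<inter> K \<noteq> {}"
    using inB[of y2 "G - B"] inK[of y2] yC t \<gamma> pathfinish_in_path_image[of \<gamma>] by blast
  have 1: "(K \<inter> coloured B) \<inter> K \<noteq> {}"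
    using inB[of y1 B] inK[of y1] yC t y1 \<gamma> pathstart_in_path_image[of \<gamma>] by blast
  have "K \<subseteq> (K \<inter> coloured B) \<union> (K \<inter> coloured (G - B))"
  proof
    fix p assume p: "p \<in> K"
    obtain y where y: "minimizer g p y"
      using exists_minimizer[of "snd p" "fst p"] Ksnd[OF p] t by auto
    have yC: "y \<in> C" by (rule KC[OF p y])
    have "0 < cut_time y" using minimizer_in_C(2)[OF yC y] Ksnd[OF p] t by simp
    then have "cut_point y \<in> closure B \<or> cut_point y \<in> closure (G - B)" by (rule cut_point_coloured[OF B yC])
    then show "p \<in> (K \<inter> coloured B) \<union> (K \<inter> coloured (G - B))"
      using p y yC Ksnd[OF p] t by (auto simp: coloured_def)
  qed
  moreover have "(K \<inter> coloured B) \<inter> (K \<inter> coloured (G - B)) \<inter> K = {}" using coloured_disjoint[OF B] by blast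
  ultimately show False
    using \<open>connected K\<close> closedK[OF B] closedK[OF saturated_Diff[OF B]] 1 2 unfolding connected_closed by blast
qed

end

section \<open>The remaining points of F\<close>

text \<open>
Such a \<open>z\<close> minimizes \<open>g\<close> in the open half space of \<open>y\<close>.
\<close>

lemma same_value_critical:
  assumes y: "grad g y \<noteq> 0" "y \<notin> E_set g" and z: "0 < (z - y) \<bullet> nu y" "g z = g y"
  shows "grad g z = 0"
proof -
  have "open {z. 0 < (z - y) \<bullet> nu y}" by (intro open_Collect_less continuous_intros)
  then have "(\<lambda>h. h \<bullet> grad g z) = (\<lambda>h. 0)"
    using z not_E_set_ge[OF y] by (intro differential_zero_maxmin[OF _ _ has_derivative_grad]) auto
  from fun_cong[OF this, of "grad g z"] show ?thesis by simp
qed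

text \<open>
If \<open>y\<close> had a rival in every tangent ball, critical points would accumulate at \<open>y\<close>.
\<close>

lemma initially_unique:
  assumes y: "grad g y \<noteq> 0" "y \<notin> E_set g"
  shows "\<exists>s>0. unique_minimizer g (char_line g y s, s) y"
proof (rule ccontr)
  assume n: "\<not> ?thesis"
  define s where "s k = inverse (real (Suc k))" for k
  have s: "0 < s k" for k by (simp add: s_def)
  have "\<exists>w. grad g w = 0 \<and> norm (w - y) \<le> 2 * s k" for k
  proof -
    obtain w where w: "w \<noteq> y" "g w = g y" "(w - y) \<bullet> (w - y) \<le> 2 * s k * ((w - y) \<bullet> nu y)" "0 < (w - y) \<bullet> nu y"
      by (rule other_minimizer[OF y(1) s[of k] not_E_set_minimizer[OF y]]) (use n s[of k] in auto)
    have "norm (w - y) * norm (w - y) = (w - y) \<bullet> (w - y)" by (simp add: norm_eq_sqrt_inner)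
    also have "\<dots> \<le> 2 * s k * ((w - y) \<bullet> nu y)" by (rule w(3))
    also have "\<dots> \<le> 2 * s k * norm (w - y)"
      using norm_cauchy_schwarz[of "w - y" "nu y"] s[of k] norm_nu[OF y(1)] by (intro mult_left_mono) auto
    finally have "norm (w - y) \<le> 2 * s k" using w(1) by simp
    then show ?thesis using same_value_critical[OF y w(4,2)] by blast
  qed
  then obtain w where w: "\<And>k. grad g (w k) = 0" "\<And>k. norm (w k - y) \<le> 2 * s k" by metis
  have "(\<lambda>k. norm (w k - y)) \<longlonglongrightarrow> 0"
    by (rule tendsto_sandwich[OF _ _ tendsto_const tendsto_mult_right_zero[OF LIMSEQ_inverse_real_of_nat, of 2]])
       (use w(2) in \<open>auto simp: s_def\<close>)
  then have "w \<longlonglongrightarrow> y" using tendsto_norm_zero_iff LIM_zero_cancel by blast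
  then have "(\<lambda>k. grad g (w k)) \<longlonglongrightarrow> grad g y" by (rule tendsto_grad)
  then show False using w(1) y(1) LIMSEQ_unique tendsto_const by (metis (no_types, lifting) ext)
qed

text \<open>
Choose times \<open>s < s'\<close> close to the last time of uniqueness with \<open>y\<close> unique at \<open>s\<close> and with a rival \<open>w\<close>
at \<open>s'\<close>. Push the point of the characteristic at time \<open>s\<close> slightly in the direction \<open>nu y\<close>. Its minimizer
\<open>z\<close> is close to \<open>y\<close> and satisfies \<open>g z > g y = g w\<close>; so \<open>z\<close> is in \<open>C\<close>, it minimizes up to time \<open>s\<close>, but
\<open>w\<close> beats it shortly after \<open>s'\<close>. Thus the cut time of \<open>z\<close> is close to \<open>s'\<close>, even if that of \<open>y\<close> is infinite.
\<close>

lemma boundary_ray_approximation: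
  assumes y: "grad g y \<noteq> 0" "y \<notin> E_set g"
    and n: "0 < t0" "\<not> unique_minimizer g (char_line g y t0, t0) y"
    and V: "open V" "y \<in> V" "\<And>z. z \<in> V \<Longrightarrow> g y < g z \<Longrightarrow> z \<in> E_set g \<inter> C" and e: "0 < e"
  obtains z r where "z \<in> C" "0 < cut_time z" "0 < r"
    "\<not> unique_minimizer g (char_line g y r, r) y" "dist (cut_point z) (char_point y r) < e"
proof -
  define U where "U = {s. 0 < s \<and> unique_minimizer g (char_line g y s, s) y}"
  have U: "U \<noteq> {}" using initially_unique[OF y] by (auto simp: U_def)
  have bdd: "bdd_above U"
  proof (rule bdd_aboveI)
    fix s assume s: "s \<in> U"
    show "s \<le> t0"
    proof (rule ccontr)
      assume "\<not> s \<le> t0"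
      then show False using unique_minimizer_char_line_mono[OF y(1), of t0 s] n s by (auto simp: U_def)
    qed
  qed
  \<comment> \<open>the cut time lies within \<open>3 e'\<close> of \<open>s''\<close>, which costs \<open>6 e'\<close>, and moving the foot point costs \<open>e'\<close>\<close>
  define e' where "e' = e / 8"
  have e': "0 < e'" using e by (simp add: e'_def)
  obtain s where s: "s \<in> U" "Sup U - e' < s" using less_cSupD[OF U, of "Sup U - e'"] e' by auto
  have "s \<le> Sup U" using s bdd by (intro cSup_upper)
  have s0: "0 < s" and us: "unique_minimizer g (char_line g y s, s) y" using s by (auto simp: U_def)
  define s' where "s' = Sup U + e'"
  define s'' where "s'' = Sup U + 2 * e'"
  have ord: "s < s'" "s' < s''" "s'' - s < 3 * e'" using s \<open>s \<le> Sup U\<close> e' by (auto simp: s'_def s''_def)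
  have "s' \<notin> U" using cSup_upper[OF _ bdd, of s'] e' by (auto simp: s'_def)
  then have n': "\<not> unique_minimizer g (char_line g y s', s') y" using ord s0 by (auto simp: U_def)
  then have n'': "\<not> unique_minimizer g (char_line g y s'', s'') y"
    using unique_minimizer_char_line_mono[OF y(1), of s' s''] ord s0 by auto
  obtain w where w: "w \<noteq> y" "g w = g y" "(w - y) \<bullet> (w - y) \<le> 2 * s' * ((w - y) \<bullet> nu y)"
    by (rule other_minimizer[OF y(1) _ not_E_set_minimizer[OF y] n']) (use ord s0 in auto)
  define l where "l k = inverse (real (Suc k))" for k
  have l: "0 < l k" for k by (simp add: l_def)
  define q where "q k = (char_line g y s + l k *\<^sub>R nu y, s)" for k
  have "\<exists>z. minimizer g (q k) z" for k unfolding q_def using s0 by (intro exists_minimizer) simp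
  then obtain z where z: "\<And>k. minimizer g (q k) (z k)" by metis
  have "q \<longlonglongrightarrow> (char_line g y s + 0 *\<^sub>R nu y, s)"
    unfolding q_def l_def by (intro tendsto_intros LIMSEQ_inverse_real_of_nat)
  then have "q \<longlonglongrightarrow> (char_line g y s, s)" by simp
  then obtain r z' where z': "(z \<circ> r) \<longlonglongrightarrow> z'" "minimizer g (char_line g y s, s) z'"
    by (rule minimizer_subsequence[OF z])
  then have "z' = y" using us by (simp add: unique_minimizer_def)
  then have zl: "(\<lambda>k. z (r k)) \<longlonglongrightarrow> y" using z'(1) by (simp add: o_def)
  have "\<forall>\<^sub>F k in sequentially. (w - z (r k)) \<bullet> (w - z (r k)) \<le> 2 * s'' * ((w - z (r k)) \<bullet> nu (z (r k)))"
    by (rule eventually_compose_filterlim[OF tangent_ball_nearby[OF y(1) _ ord(2) w(1,3)] zl]) (use ord s0 in simp)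
  moreover have "\<forall>\<^sub>F k in sequentially. z (r k) \<in> V"
    by (rule eventually_compose_filterlim[OF eventually_nhds_in_open[OF V(1,2)] zl])
  moreover have "\<forall>\<^sub>F k in sequentially. grad g (z (r k)) \<noteq> 0"
    by (rule tendsto_imp_eventually_ne[OF tendsto_grad[OF zl] y(1)])
  moreover have "\<forall>\<^sub>F k in sequentially. dist (char_point (z (r k)) s'') (char_point y s'') < e'"
    using tendsto_char_point[OF zl tendsto_const y(1), of s''] e' by (rule tendstoD)
  ultimately have "\<forall>\<^sub>F k in sequentially. (w - z (r k)) \<bullet> (w - z (r k)) \<le> 2 * s'' * ((w - z (r k)) \<bullet> nu (z (r k)))
      \<and> z (r k) \<in> V \<and> grad g (z (r k)) \<noteq> 0 \<and> dist (char_point (z (r k)) s'') (char_point y s'') < e'"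
    by eventually_elim simp
  then obtain k where k: "(w - z (r k)) \<bullet> (w - z (r k)) \<le> 2 * s'' * ((w - z (r k)) \<bullet> nu (z (r k)))"
      "z (r k) \<in> V" "grad g (z (r k)) \<noteq> 0" "dist (char_point (z (r k)) s'') (char_point y s'') < e'"
    using eventually_happens[of _ sequentially] by force
  define v where "v = z (r k)"
  have v: "norm (v - (char_line g y s + l (r k) *\<^sub>R nu y)) \<le> s"
    using z[of "r k"] by (simp add: v_def q_def minimizer_iff)
  have nn: "nu y \<bullet> nu y = 1" using norm_nu[OF y(1)] by (simp add: dot_square_norm)
  have "- s \<le> (v - (char_line g y s + l (r k) *\<^sub>R nu y)) \<bullet> nu y"
    using v Cauchy_Schwarz_ineq2[of "v - (char_line g y s + l (r k) *\<^sub>R nu y)" "nu y"] norm_nu[OF y(1)] by simp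
  then have "l (r k) \<le> (v - y) \<bullet> nu y"
    using nn by (simp add: char_line_nu inner_diff_left inner_add_left)
  then have pos: "0 < (v - y) \<bullet> nu y" using l[of "r k"] by linarith
  then have "g y \<le> g v" by (rule not_E_set_ge[OF y])
  moreover have "g v \<noteq> g y" using same_value_critical[OF y pos] k by (auto simp: v_def)
  ultimately have gv: "g y < g v" by simp
  have vC: "v \<in> C" "v \<in> E_set g" using V(3)[OF _ gv] k by (auto simp: v_def)
  have mv: "minimizer g (char_line g y s + l (r k) *\<^sub>R nu y, s) v" using z[of "r k"] by (simp add: v_def q_def)
  then have "minimizer g (char_line g v s, s) v"
    using minimizer_on_char_line[OF mv E_set_grad[OF vC(2)]] by simp
  then have low: "s \<le> cut_time v" using cut_time_iff[OF vC(2)] s0 by simp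
  have "\<not> minimizer g (char_line g v s'', s'') v"
    using minimizer_char_line_iff[OF E_set_grad[OF vC(2)], of s''] k(1) w(2) gv ord s0
    by (force simp: v_def)
  then have high: "cut_time v < s''" using cut_time_iff[OF vC(2), of s''] ord s0 by simp
  have "dist (cut_point v) (char_point y s'') \<le> dist (cut_point v) (char_point v s'') + dist (char_point v s'') (char_point y s'')"
    by (rule dist_triangle)
  also have "dist (cut_point v) (char_point v s'') \<le> 2 * \<bar>cut_time v - s''\<bar>"
    unfolding cut_point_def by (rule dist_char_point[OF E_set_grad[OF vC(2)]])
  finally have "dist (cut_point v) (char_point y s'') < e" using k(4) low high ord by (simp add: v_def e'_def)
  then show ?thesis using that[of v s''] vC low s0 ord n'' by auto
qed

lemma F_set_cases:
  assumes "y \<in> F_set g C"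
  obtains "y \<in> C" |
    V where "y \<in> M_set g" "y \<notin> E_set g" "open V" "y \<in> V" "\<And>z. z \<in> V \<Longrightarrow> g y < g z \<Longrightarrow> z \<in> C"
proof (cases "y \<in> C")
  case False
  then obtain N U where NU: "y \<in> M_set g - E_set g" "level_nbhd g y N" "open U" "y \<in> U" "U \<inter> H_plus g N y \<subseteq> C"
    using assms by (auto simp: F_set_def)
  have "open (U \<inter> N)" "y \<in> U \<inter> N" using NU by (auto simp: level_nbhd_def)
  moreover have "\<And>z. z \<in> U \<inter> N \<Longrightarrow> g y < g z \<Longrightarrow> z \<in> C" using NU(5) by (auto simp: H_plus_def)
  ultimately show ?thesis using that(2)[of "U \<inter> N"] NU(1) by blast
qed (use that in blast)

text \<open>
Every part of \<open>G\<^sub>C\<close> is reached by the cut points of \<open>C\<close>: a singular point with a minimizer \<open>y\<close> in \<open>C\<close>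
has the colour of \<open>y\<close>, and the singular ray of any other \<open>y\<close> in \<open>F\<^sub>C\<close> is connected and arbitrarily close to
cut points of \<open>C\<close>. As the colour is constant on \<open>C\<close>, there is just one part.
\<close>

lemma almost_connected_singular_points:
  assumes C: "C \<in> path_comps (E_set g)"
  shows "almost_connected (singular_points (F_set g C))" (is "almost_connected ?G")
  unfolding almost_connected_iff
proof (intro allI impI)
  fix \<delta> :: real and B assume \<delta>: "0 < \<delta>" and B: "saturated \<delta> ?G B" and ne: "B \<noteq> {}"
  note CE = path_comps_E_set(1,2)[OF C]
  have G: "singular_points C \<subseteq> ?G" "?G \<subseteq> singular_points UNIV"
    by (auto simp: singular_points_def F_set_def)
  have reach: "\<exists>y\<in>C. 0 < cut_time y \<and> cut_point y \<in> closure B'"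
    if B': "saturated \<delta> ?G B'" and p: "p \<in> B'" for p B'
  proof -
    have pG: "p \<in> ?G" using B' p by (auto simp: saturated_def)
    then obtain y t where y: "y \<in> F_set g C" "0 < t" "grad g y \<noteq> 0" "p = (char_line g y t, t)"
      "minimizer g (char_line g y t, t) y" and n: "\<not> unique_minimizer g (char_line g y t, t) y"
      by (rule singular_pointsE)
    have pt: "p = char_point y t" using y by (simp add: char_point_def)
    from y(1) show ?thesis
    proof (cases rule: F_set_cases)
      case 1
      then have le: "t \<le> cut_time y" using cut_time_iff[of y t] y CE by auto
      have "cut_point y \<in> closure B'"
        using p pt closure_subset[of B'] by (intro cut_point_colour[OF CE G \<delta> B' 1 y(2) le]) blast
      then show ?thesis using 1 le y(2) by force
    next
      case (2 V)
      obtain z r where z: "z \<in> C" "0 < cut_time z" and r: "0 < r" "\<not> unique_minimizer g (char_line g y r, r) y"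
        and d: "dist (cut_point z) (char_point y r) < \<delta>"
        by (rule boundary_ray_approximation[OF y(3) 2(2) y(2) n 2(3,4), of C \<delta>]) (use 2(5) CE \<delta> in blast)+
      define K where "K = char_point y ` {min r t..max r t}"
      have "connected K" unfolding K_def char_point_nu[abs_def]
        by (intro connected_continuous_image continuous_intros connected_Icc)
      moreover have "K \<subseteq> ?G"
      proof
        fix a assume "a \<in> K"
        then obtain c where c: "min r t \<le> c" "a = char_point y c" by (auto simp: K_def)
        have mn: "0 < min r t" "\<not> unique_minimizer g (char_line g y (min r t), min r t) y"
          using r n y(2) by (auto simp: min_def)
        then have "\<not> unique_minimizer g (char_line g y c, c) y"
          using unique_minimizer_char_line_mono[OF y(3), of "min r t" c] c by auto
        then show "a \<in> ?G" unfolding c char_point_def using y(1,3) mn c not_E_set_minimizer[OF y(3) 2(2), of c]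
          by (intro singular_pointsI) auto
      qed
      moreover have "char_point y t \<in> K" unfolding K_def by (intro imageI) simp
      then have "K \<inter> B' \<noteq> {}" using p pt by blast
      ultimately have "K \<subseteq> B'" by (rule saturated_connected[OF \<delta> B'])
      moreover have "char_point y r \<in> K" unfolding K_def by (intro imageI) simp
      ultimately have rB: "char_point y r \<in> closure B'" using closure_subset[of B'] by blast
      have zG: "cut_point z \<in> closure ?G"
        using cut_point_in_closure[OF CE z] closure_mono[OF G(1)] by blast
      have "cut_point z \<in> closure B'"
        using d by (intro saturated_closure[OF B' rB zG]) (simp add: dist_commute)
      then show ?thesis using z by blast
    qed
  qed
  show "B = ?G"
  proof (rule ccontr)
    assume "B \<noteq> ?G"
    then obtain a b where "a \<in> ?G - B" "b \<in> B" using B ne by (auto simp: saturated_def)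
    then obtain y1 y2 where y: "y1 \<in> C" "0 < cut_time y1" "cut_point y1 \<in> closure B"
      "y2 \<in> C" "0 < cut_time y2" "cut_point y2 \<in> closure (?G - B)"
      using reach[OF B] reach[OF saturated_Diff[OF B]] by blast
    have "cut_point y2 \<in> closure B"
      by (rule colour_constant[OF CE G \<delta> B path_comps_E_set(4)[OF C y(1,4)] y(2,5,3)])
    then show False using saturated_disjoint_closure[OF \<delta> B] y by blast
  qed
qed

end

section \<open>The components of the singular set\<close>

theorem theorem3p39:
  fixes g :: "real ^ 'n \<Rightarrow> real"
  assumes "C1_on g UNIV"
  shows "\<exists>\<S>. countable \<S> \<and> singular_set g = \<Union>\<S> \<and>
    (\<forall>S\<in>\<S>. (S \<in> components (singular_set g) \<or> S \<in> almost_components (singular_set g)) \<and>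
      (\<exists>\<C>. countable \<C> \<and> \<C> \<subseteq> path_comps (E_set g) \<and>
        S = (\<Union>C\<in>\<C>. T_set g (F_set g C) - unique_minimizer_set g)))"
proof -
  interpret C1_function g using assms by unfold_locales
  have eq: "T_set g (F_set g C) - unique_minimizer_set g = singular_points (F_set g C)"
    if "C \<in> path_comps (E_set g)" for C
    using that path_comps_E_set(2) F_set_grad by (intro T_set_minus_unique) blast
  let ?union = "\<lambda>S. \<exists>\<C>. countable \<C> \<and> \<C> \<subseteq> path_comps (E_set g) \<and>
      S = (\<Union>C\<in>\<C>. T_set g (F_set g C) - unique_minimizer_set g)"
  have "\<exists>\<S>. countable \<S> \<and> singular_set g = \<Union>\<S> \<and>
    (\<forall>S\<in>\<S>. S \<in> almost_components (singular_set g) \<and> ?union S)"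
  proof (rule almost_component_partition[OF countable_path_comps])
    show "singular_set g = (\<Union>C\<in>path_comps (E_set g). T_set g (F_set g C) - unique_minimizer_set g)"
      unfolding singular_set_union using eq by simp
    show "almost_connected (T_set g (F_set g C) - unique_minimizer_set g)" if "C \<in> path_comps (E_set g)" for C
      unfolding eq[OF that] by (rule almost_connected_singular_points[OF that])
  qed
  then obtain \<S> where \<S>: "countable \<S>" "singular_set g = \<Union>\<S>"
    and S: "\<forall>S\<in>\<S>. S \<in> almost_components (singular_set g) \<and> ?union S"
    by (elim exE conjE) (rule that)
  have "\<forall>S\<in>\<S>. (S \<in> components (singular_set g) \<or> S \<in> almost_components (singular_set g)) \<and> ?union S"
  proof
    fix S assume "S \<in> \<S>"
    from bspec[OF S this]
    show "(S \<in> components (singular_set g) \<or> S \<in> almost_components (singular_set g)) \<and> ?union S"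
      by (elim conjE) (intro conjI disjI2)
  qed
  with \<S> show ?thesis by (intro exI[of _ \<S>] conjI)
qed

end
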